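(* Let $d\ge 0$ be an integer and let $S(2,d)$ be the Schur algebra over $\mathbb{Q}$ (defined in the context). Then $S(2,d)$ is isomorphic with the associative $\mathbb{Q}$-algebra with $1$ generated by $e,f,H_2$ subject to the relations $$H_2e-eH_2=-e,\qquad ef-fe=d-2H_2,\qquad H_2f-fH_2=f,$$ $$H_2(H_2-1)\cdots(H_2-d)=0.$$ Moreover, this presented algebra has a $\mathbb{Q}$-basis consisting of all $f^a H_2^b e^c$ with $a,b,c$ nonnegative integers such that $a+b+c\le d$.
   Context: Let $E$ be a $2$-dimensional $\mathbb{Q}$-vector space with fixed basis $e_1,e_2$, identifying $GL(E)$ with $GL_2(\mathbb{Q})$. The group $GL_2(\mathbb{Q})$ acts diagonally on $E^{\otimes d}$; extending linearly gives a representation of the group algebra $\mathbb{Q}GL_2(\mathbb{Q})\to\mathrm{End}(E^{\otimes d})$, and the Schur algebra $S(2,d)$ is its image. Equivalently, $S(2,d)$ is the image of the differentiated representation $\rho_d:U(\mathfrak{gl}_2)\to\mathrm{End}(E^{\otimes d})$ of the universal enveloping algebra. *)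

theory Defs
  imports Complex_Main
begin

text \<open>Basis vectors e_1, e_2 of E are indexed by 0, 1.  The basis of E^{\<otimes>d}
consists of the pure tensors e_{w_1} \<otimes> ... \<otimes> e_{w_d}, indexed by words w
of length d over {0,1}.  Endomorphisms of E^{\<otimes>d} are represented by their
matrices, i.e. functions on pairs of words, required to vanish outside
the index set.\<close>

type_synonym endo = "nat list \<Rightarrow> nat list \<Rightarrow> rat"

definition words :: "nat \<Rightarrow> nat list set" where
  "words d = {w. length w = d \<and> set w \<subseteq> {0, 1}}"

definition endos :: "nat \<Rightarrow> endo set" where
  "endos d = {M. \<forall>v w. (v \<notin> words d \<or> w \<notin> words d) \<longrightarrow> M v w = 0}"

definition endo_id :: "nat \<Rightarrow> endo" where
  "endo_id d = (\<lambda>v w. if v \<in> words d \<and> v = w then 1 else 0)"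

definition endo_mult :: "nat \<Rightarrow> endo \<Rightarrow> endo \<Rightarrow> endo" where
  "endo_mult d M N = (\<lambda>v w. \<Sum>u\<in>words d. M v u * N u w)"

definition endo_add :: "endo \<Rightarrow> endo \<Rightarrow> endo" where
  "endo_add M N = (\<lambda>v w. M v w + N v w)"

definition endo_scale :: "rat \<Rightarrow> endo \<Rightarrow> endo" where
  "endo_scale c M = (\<lambda>v w. c * M v w)"

definition invertible2 :: "(nat \<Rightarrow> nat \<Rightarrow> rat) \<Rightarrow> bool" where
  "invertible2 g \<longleftrightarrow> g 0 0 * g 1 1 - g 0 1 * g 1 0 \<noteq> 0"

definition tensor_power :: "nat \<Rightarrow> (nat \<Rightarrow> nat \<Rightarrow> rat) \<Rightarrow> endo" where
  "tensor_power d g = (\<lambda>v w. if v \<in> words d \<and> w \<in> words d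
       then (\<Prod>i<d. g (v ! i) (w ! i)) else 0)"

text \<open>The Schur algebra: the image of the group algebra Q GL_2(Q), i.e. the
Q-linear span of the operators g^{\<otimes>d}, g \<in> GL_2(Q).\<close>
definition schur :: "nat \<Rightarrow> endo set" where
  "schur d = {M. \<exists>G c. finite G \<and> G \<subseteq> {tensor_power d g | g. invertible2 g} \<and>
                   M = (\<lambda>v w. \<Sum>A\<in>G. c A * A v w)}"

datatype gen = Ge | Gf | Gh

text \<open>Noncommutative polynomials: finitely supported functions from words
over the generators to Q.\<close>
type_synonym fa = "gen list \<Rightarrow> rat"

definition FA :: "fa set" where
  "FA = {p. finite {w. p w \<noteq> 0}}"

definition fa_zero :: fa where "fa_zero = (\<lambda>w. 0)"
definition fa_one :: fa where "fa_one = (\<lambda>w. if w = [] then 1 else 0)"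
definition fa_gen :: "gen \<Rightarrow> fa" where "fa_gen x = (\<lambda>w. if w = [x] then 1 else 0)"
definition fa_add :: "fa \<Rightarrow> fa \<Rightarrow> fa" where "fa_add p q = (\<lambda>w. p w + q w)"
definition fa_scale :: "rat \<Rightarrow> fa \<Rightarrow> fa" where "fa_scale c p = (\<lambda>w. c * p w)"
definition fa_sub :: "fa \<Rightarrow> fa \<Rightarrow> fa" where "fa_sub p q = (\<lambda>w. p w - q w)"
definition fa_mult :: "fa \<Rightarrow> fa \<Rightarrow> fa" where
  "fa_mult p q = (\<lambda>w. \<Sum>i\<le>length w. p (take i w) * q (drop i w))"

fun fa_pow :: "fa \<Rightarrow> nat \<Rightarrow> fa" where
  "fa_pow p 0 = fa_one"
| "fa_pow p (Suc n) = fa_mult (fa_pow p n) p"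

abbreviation "gE \<equiv> fa_gen Ge"
abbreviation "gF \<equiv> fa_gen Gf"
abbreviation "gH \<equiv> fa_gen Gh"

fun hprod :: "nat \<Rightarrow> fa" where
  "hprod 0 = gH"
| "hprod (Suc k) = fa_mult (hprod k) (fa_sub gH (fa_scale (of_nat (Suc k)) fa_one))"

definition relations :: "nat \<Rightarrow> fa set" where
  "relations d =
    { fa_sub (fa_sub (fa_mult gH gE) (fa_mult gE gH)) (fa_scale (-1) gE),
      fa_sub (fa_sub (fa_mult gE gF) (fa_mult gF gE))
             (fa_sub (fa_scale (of_nat d) fa_one) (fa_scale 2 gH)),
      fa_sub (fa_sub (fa_mult gH gF) (fa_mult gF gH)) gF,
      hprod d }"

inductive_set rel_ideal :: "nat \<Rightarrow> fa set" for d where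
  zero: "fa_zero \<in> rel_ideal d"
| rel: "r \<in> relations d \<Longrightarrow> r \<in> rel_ideal d"
| add: "p \<in> rel_ideal d \<Longrightarrow> q \<in> rel_ideal d \<Longrightarrow> fa_add p q \<in> rel_ideal d"
| scale: "p \<in> rel_ideal d \<Longrightarrow> fa_scale c p \<in> rel_ideal d"
| lmult: "p \<in> rel_ideal d \<Longrightarrow> a \<in> FA \<Longrightarrow> fa_mult a p \<in> rel_ideal d"
| rmult: "p \<in> rel_ideal d \<Longrightarrow> a \<in> FA \<Longrightarrow> fa_mult p a \<in> rel_ideal d"

definition alg_hom :: "nat \<Rightarrow> (fa \<Rightarrow> endo) \<Rightarrow> bool" where
  "alg_hom d \<phi> \<longleftrightarrow>
     (\<forall>p\<in>FA. \<phi> p \<in> endos d) \<and>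
     \<phi> fa_one = endo_id d \<and>
     (\<forall>p\<in>FA. \<forall>q\<in>FA. \<phi> (fa_add p q) = endo_add (\<phi> p) (\<phi> q)) \<and>
     (\<forall>c. \<forall>p\<in>FA. \<phi> (fa_scale c p) = endo_scale c (\<phi> p)) \<and>
     (\<forall>p\<in>FA. \<forall>q\<in>FA. \<phi> (fa_mult p q) = endo_mult d (\<phi> p) (\<phi> q))"

definition monom :: "nat \<times> nat \<times> nat \<Rightarrow> fa" where
  "monom m = (case m of (a, b, c) \<Rightarrow>
      fa_mult (fa_mult (fa_pow gF a) (fa_pow gH b)) (fa_pow gE c))"

definition monom_idx :: "nat \<Rightarrow> (nat \<times> nat \<times> nat) set" where
  "monom_idx d = {(a, b, c). a + b + c \<le> d}"

definition lin_comb :: "nat \<Rightarrow> (nat \<times> nat \<times> nat \<Rightarrow> rat) \<Rightarrow> fa" where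
  "lin_comb d k = (\<lambda>w. \<Sum>m\<in>monom_idx d. k m * monom m w)"

end

theory Submission
  imports Defs "HOL-Library.Function_Algebras" "HOL-Computational_Algebra.Polynomial"
begin

text \<open>The generators e, f, H_2 act on the tensor power as the differentials of the matrix units
E_12, E_21, E_22, and all four relations hold there. The divided powers of e and f and the weight
projections are the coefficients of the operators of unipotent and diagonal matrices. Interpolation
extracts these coefficients, so the image lies in the Schur algebra; the Gauss decomposition gives
the converse inclusion. The matrices of the monomials are triangular, hence independent.

For the spanning, filter by word length. Letters commute up to shorter words, so only the monomials
f^a H^b e^c with a + b + c = d + 1 have to be expressed by shorter words. This holds for H^(d+1) by
the last relation, and the property is preserved by the commutators with e and f: bracketing
H^m e^c with e gives m H^(m-1) e^(c+1), and bracketing f^a H^m e^c with f gives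
- m f^(a+1) H^(m-1) e^c + 2 c f^a H^(m+1) e^(c-1), modulo shorter words. Since the ideal of relations
is killed by the representation and the monomials span the quotient, their independence in the
Schur algebra shows that the ideal is the whole kernel.\<close>

section \<open>Interpolation\<close>

lemma lagrange_basis:
  fixes x :: "nat \<Rightarrow> rat"
  assumes "inj_on x {..n}"
  obtains L :: "nat \<Rightarrow> rat poly"
  where "\<And>i. i \<le> n \<Longrightarrow> degree (L i) \<le> n"
    and "\<And>i j. i \<le> n \<Longrightarrow> j \<le> n \<Longrightarrow> poly (L i) (x j) = (if i = j then 1 else 0)"
proof
  define L where
    "L i = (\<Prod>j\<in>{..n} - {i}. smult (inverse (x i - x j)) [:- x j, 1:])" for i
  fix i assume i: "i \<le> n"
  have factor: "degree (smult c [:- y, 1:]) \<le> 1" for c y :: rat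
    by (rule order_trans[OF degree_smult_le]) simp
  have "degree (L i) \<le> (\<Sum>j\<in>{..n} - {i}. 1)"
    unfolding L_def by (rule order_trans[OF degree_prod_sum_le])
      (simp, unfold o_def, intro sum_mono factor)
  also have "\<dots> = n" using i by simp
  finally show "degree (L i) \<le> n" .
  fix j assume j: "j \<le> n"
  have ev: "poly (L i) (x j) = (\<Prod>k\<in>{..n} - {i}. inverse (x i - x k) * (x j - x k))"
    by (simp add: L_def poly_prod algebra_simps)
  show "poly (L i) (x j) = (if i = j then 1 else 0)"
  proof (cases "i = j")
    case True
    have "x i - x k \<noteq> 0" if "k \<in> {..n} - {i}" for k
      using assms i that by (auto simp: inj_on_def)
    then have "(\<Prod>k\<in>{..n} - {i}. inverse (x i - x k) * (x i - x k)) = 1"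
      by (intro prod.neutral) simp
    with ev True show ?thesis by simp
  next
    case False
    with ev j show ?thesis by auto
  qed
qed

lemma interpolation:
  fixes x :: "nat \<Rightarrow> rat"
  assumes "inj_on x {..n}"
  obtains p where "degree p \<le> n" "\<And>i. i \<le> n \<Longrightarrow> poly p (x i) = g i"
proof -
  obtain L :: "nat \<Rightarrow> rat poly" where L: "\<And>i. i \<le> n \<Longrightarrow> degree (L i) \<le> n"
    "\<And>i j. i \<le> n \<Longrightarrow> j \<le> n \<Longrightarrow> poly (L i) (x j) = (if i = j then 1 else 0)"
    using lagrange_basis[OF assms] by metis
  define p where "p = (\<Sum>i\<le>n. smult (g i) (L i))"
  have "degree p \<le> n" unfolding p_def
    by (intro degree_sum_le) (auto intro: order_trans[OF degree_smult_le] L)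
  moreover have "poly p (x i) = g i" if "i \<le> n" for i
    using that by (simp add: p_def poly_sum L(2) if_distrib[of "(*) _"] cong: if_cong)
  ultimately show thesis by (rule that)
qed

text \<open>The transposed Vandermonde system: a linear functional on polynomials of degree at most
  n is a combination of evaluations at n + 1 nodes. For operators that depend polynomially on a
  parameter, such a combination of values isolates a coefficient.\<close>

lemma dual_interpolation:
  fixes x g :: "nat \<Rightarrow> rat"
  assumes "inj_on x {..n}"
  obtains c where "\<And>b. b \<le> n \<Longrightarrow> (\<Sum>i\<le>n. c i * x i ^ b) = g b"
proof -
  obtain L :: "nat \<Rightarrow> rat poly" where L: "\<And>i. i \<le> n \<Longrightarrow> degree (L i) \<le> n"
    "\<And>i j. i \<le> n \<Longrightarrow> j \<le> n \<Longrightarrow> poly (L i) (x j) = (if i = j then 1 else 0)"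
    using lagrange_basis[OF assms] by metis
  \<comment> \<open>Each power t^b with b at most n is its own interpolation polynomial, since both
    sides agree at \<open>Suc n\<close> nodes and have smaller degree.\<close>
  have monom: "(\<Sum>i\<le>n. smult (x i ^ b) (L i)) = Polynomial.monom 1 b" if "b \<le> n" for b
  proof (rule poly_eqI_degree[where A = "x ` {..n}"])
    show "poly (\<Sum>i\<le>n. smult (x i ^ b) (L i)) y = poly (Polynomial.monom 1 b) y"
      if "y \<in> x ` {..n}" for y
      using that by (auto simp: poly_sum poly_monom L(2) if_distrib[of "(*) _"] cong: if_cong)
    have card: "card (x ` {..n}) = Suc n" using assms by (simp add: card_image)
    have "degree (\<Sum>i\<le>n. smult (x i ^ b) (L i)) \<le> n"
      by (intro degree_sum_le) (auto intro: order_trans[OF degree_smult_le] L)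
    with card show "degree (\<Sum>i\<le>n. smult (x i ^ b) (L i)) < card (x ` {..n})" by simp
    show "degree (Polynomial.monom (1 :: rat) b) < card (x ` {..n})"
      using card that by (simp add: degree_monom_eq)
  qed
  \<comment> \<open>The functional sending t^m to \<open>g m\<close>, evaluated at the Lagrange
    polynomial \<open>L i\<close>.\<close>
  define c where "c i = (\<Sum>m\<le>n. g m * coeff (L i) m)" for i
  have "(\<Sum>i\<le>n. c i * x i ^ b) = g b" if b: "b \<le> n" for b
  proof -
    have "(\<Sum>i\<le>n. c i * x i ^ b) = (\<Sum>m\<le>n. g m * (\<Sum>i\<le>n. x i ^ b * coeff (L i) m))"
      unfolding c_def sum_distrib_right sum_distrib_left
      by (subst sum.swap) (simp add: mult_ac)
    also have "\<dots> = (\<Sum>m\<le>n. g m * coeff (Polynomial.monom 1 b) m)"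
      by (simp add: monom[OF b, symmetric] coeff_sum)
    also have "\<dots> = g b" using b by (simp add: if_distrib[of "(*) _"] cong: if_cong)
    finally show ?thesis .
  qed
  then show thesis by (rule that)
qed

section \<open>Operators on the tensor power\<close>

lemma words_0: "words 0 = {[]}"
  by (auto simp: words_def)

lemma words_Suc: "words (Suc d) = (#) 0 ` words d \<union> (#) 1 ` words d"
  by (auto simp: words_def length_Suc_conv image_iff)

lemma Cons_in_words [simp]: "a # v \<in> words (Suc d) \<longleftrightarrow> a \<in> {0, 1} \<and> v \<in> words d"
  by (auto simp: words_def)

lemma words_SucE:
  assumes "v \<in> words (Suc d)"
  obtains a v' where "v = a # v'" "a = 0 \<or> a = 1" "v' \<in> words d"
  using assms by (auto simp: words_Suc)

lemma finite_words [simp]: "finite (words d)"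
  by (induction d) (auto simp: words_0 words_Suc)

lemma sum_words_Suc:
  "(\<Sum>u\<in>words (Suc d). f u) = (\<Sum>u\<in>words d. f (0 # u)) + (\<Sum>u\<in>words d. f (1 # u))"
  unfolding words_Suc by (subst sum.union_disjoint) (auto simp: sum.reindex)

lemma sum_list_words_le: "w \<in> words d \<Longrightarrow> sum_list w \<le> d"
  by (induction d arbitrary: w) (force simp: words_0 elim!: words_SucE)+

text \<open>The divided power e^c / c!. Columns index the input, so the entry at (v, w) is 1 exactly
  when v arises from w by turning c letters 1 into 0.\<close>

definition divE :: "nat \<Rightarrow> nat \<Rightarrow> endo" where
  "divE d c = (\<lambda>v w. if v \<in> words d \<and> w \<in> words d \<and> list_all2 (\<le>) v w \<and>
                        sum_list w = sum_list v + c then 1 else 0)"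

definition endo_transp :: "endo \<Rightarrow> endo" where
  "endo_transp M = (\<lambda>v w. M w v)"

abbreviation divF :: "nat \<Rightarrow> nat \<Rightarrow> endo" where
  "divF d c \<equiv> endo_transp (divE d c)"

text \<open>Operators that are scalar on each weight space. The weight is the number of letters 1,
  so \<open>diag d of_nat\<close> is H_2.\<close>

definition diag :: "nat \<Rightarrow> (nat \<Rightarrow> rat) \<Rightarrow> endo" where
  "diag d g = (\<lambda>v w. if v \<in> words d \<and> v = w then g (sum_list v) else 0)"

lemma divE_endos: "divE d c \<in> endos d"
  by (simp add: divE_def endos_def)

lemma diag_endos: "diag d g \<in> endos d"
  by (auto simp: diag_def endos_def)

lemma endo_transp_endos: "M \<in> endos d \<Longrightarrow> endo_transp M \<in> endos d"
  by (auto simp: endo_transp_def endos_def)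

lemma list_all2_le_sum_list: "list_all2 (\<le>) v w \<Longrightarrow> sum_list v \<le> sum_list (w :: nat list)"
  by (induction rule: list_all2_induct) auto

lemma list_all2_le_antisym_sum:
  "list_all2 (\<le>) v w \<Longrightarrow> sum_list v = sum_list (w :: nat list) \<Longrightarrow> v = w"
  by (induction rule: list_all2_induct) (use list_all2_le_sum_list in fastforce)+

lemma divE_0: "divE d 0 = endo_id d"
  by (auto simp: divE_def endo_id_def fun_eq_iff list.rel_refl
      dest: list_all2_le_antisym_sum[OF _ sym])

text \<open>Since e^2 = 0 on E, the divided power acts on the first tensor factor either trivially
  or by a single e, which uses up one unit of c. The inductions on d below rest on this
  recursion.\<close>

lemma divE_Cons:
  assumes "a \<in> {0, 1}" "b \<in> {0, 1}"
  shows "divE (Suc d) c (a # v) (b # w) =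
    (if a = b then divE d c v w else if a < b \<and> 0 < c then divE d (c - 1) v w else 0)"
  using assms by (auto simp: divE_def dest!: list_all2_le_sum_list)

lemma diag_Cons:
  assumes "a \<in> {0, 1}"
  shows "diag (Suc d) g (a # v) (b # w) = (if a = b then diag d (\<lambda>k. g (a + k)) v w else 0)"
  using assms by (auto simp: diag_def)

section \<open>Matrix products, weight operators and the identity\<close>

lemma endo_mult_outside:
  assumes "M \<in> endos d" "N \<in> endos d" "v \<notin> words d \<or> w \<notin> words d"
  shows "endo_mult d M N v w = 0"
  using assms by (auto simp: endo_mult_def endos_def intro!: sum.neutral)

lemma endo_mult_endos: "M \<in> endos d \<Longrightarrow> N \<in> endos d \<Longrightarrow> endo_mult d M N \<in> endos d"
  using endo_mult_outside by (auto simp: endos_def)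

lemma endo_mult_assoc:
  "endo_mult d (endo_mult d L M) N = endo_mult d L (endo_mult d M N)"
  unfolding endo_mult_def sum_distrib_left sum_distrib_right
  by (intro ext, subst sum.swap) (simp add: mult.assoc)

lemma endo_mult_diag_left:
  assumes "M \<in> endos d"
  shows "endo_mult d (diag d g) M = (\<lambda>v w. g (sum_list v) * M v w)"
proof (intro ext)
  fix v w
  have "endo_mult d (diag d g) M v w = (\<Sum>u\<in>words d. if v = u then g (sum_list v) * M v w else 0)"
    unfolding endo_mult_def diag_def by (intro sum.cong) auto
  also have "\<dots> = g (sum_list v) * M v w"
    using assms by (auto simp: endos_def)
  finally show "endo_mult d (diag d g) M v w = g (sum_list v) * M v w" .
qed

lemma endo_mult_diag_right:
  assumes "M \<in> endos d"
  shows "endo_mult d M (diag d g) = (\<lambda>v w. M v w * g (sum_list w))"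
proof (intro ext)
  fix v w
  have "endo_mult d M (diag d g) v w = (\<Sum>u\<in>words d. if u = w then M v w * g (sum_list w) else 0)"
    unfolding endo_mult_def diag_def by (intro sum.cong) auto
  also have "\<dots> = M v w * g (sum_list w)"
    using assms by (auto simp: endos_def)
  finally show "endo_mult d M (diag d g) v w = M v w * g (sum_list w)" .
qed

lemma endo_id_eq_diag: "endo_id d = diag d (\<lambda>_. 1)"
  by (simp add: endo_id_def diag_def)

lemma endo_mult_id_left: "M \<in> endos d \<Longrightarrow> endo_mult d (endo_id d) M = M"
  by (simp add: endo_id_eq_diag endo_mult_diag_left)

lemma endo_mult_id_right: "M \<in> endos d \<Longrightarrow> endo_mult d M (endo_id d) = M"
  by (simp add: endo_id_eq_diag endo_mult_diag_right)

lemma endo_mult_transp: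
  "endo_mult d (endo_transp M) (endo_transp N) = endo_transp (endo_mult d N M)"
  by (simp add: endo_mult_def endo_transp_def mult.commute)

lemma endo_eqI:
  assumes "M \<in> endos d" "N \<in> endos d"
    and "\<And>v w. v \<in> words d \<Longrightarrow> w \<in> words d \<Longrightarrow> M v w = N v w"
  shows "M = N"
proof (intro ext)
  fix v w show "M v w = N v w"
    using assms by (cases "v \<in> words d \<and> w \<in> words d") (auto simp: endos_def)
qed

lemma endo_scale_endos: "M \<in> endos d \<Longrightarrow> endo_scale c M \<in> endos d"
  by (auto simp: endo_scale_def endos_def)

section \<open>Divided power law and the bracket of e and f\<close>

lemma sum_endo_id:
  assumes "v \<in> words d"
  shows "(\<Sum>u\<in>words d. endo_id d v u * g u) = g v" "(\<Sum>u\<in>words d. g u * endo_id d v u) = g v"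
    "(\<Sum>u\<in>words d. endo_id d u v * g u) = g v" "(\<Sum>u\<in>words d. g u * endo_id d u v) = g v"
  using assms
  by (simp_all add: endo_id_def if_distrib[of "\<lambda>x. x * _"] if_distrib[of "\<lambda>x. _ * x"] cong: if_cong)

text \<open>Induction over the tensor factors. If the first letters are 0 and 1, either of the two
  operators may act on the first factor, and the two contributions add up by Pascal's rule.\<close>

lemma divE_mult_entry:
  assumes "v \<in> words d" "w \<in> words d"
  shows "(\<Sum>u\<in>words d. divE d m v u * divE d n u w) = of_nat (m + n choose m) * divE d (m + n) v w"
  using assms
proof (induction d arbitrary: m n v w)
  case 0
  then show ?case by (auto simp: words_0 divE_def)
next
  case (Suc d)
  from Suc.prems obtain a v' b w' where *: "v = a # v'" "a = 0 \<or> a = 1" "v' \<in> words d"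
      "w = b # w'" "b = 0 \<or> b = 1" "w' \<in> words d"
    by (elim words_SucE)
  note IH = Suc.IH[OF *(3,6)]
  show ?case
    using *(2,5)
    by (cases m; cases n) (auto simp: * sum_words_Suc divE_Cons IH distrib_right)
qed

lemma divE_mult:
  "endo_mult d (divE d m) (divE d n) = endo_scale (of_nat (m + n choose m)) (divE d (m + n))"
  by (rule endo_eqI[where d = d])
    (auto intro: endo_mult_endos divE_endos endo_scale_endos,
      simp add: endo_mult_def endo_scale_def divE_mult_entry)

text \<open>As f is the transpose of e, both sums use the matrix of e only. In the induction the
  mixed terms cancel, and the new tensor factor contributes 1 for the letter 0 and -1 for the letter
  1.\<close>

lemma commutator_entry:
  assumes "v \<in> words d" "w \<in> words d"
  shows "(\<Sum>u\<in>words d. divE d 1 v u * divE d 1 w u) - (\<Sum>u\<in>words d. divE d 1 u v * divE d 1 u w)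
       = diag d (\<lambda>k. of_nat d - 2 * of_nat k) v w"
  using assms
proof (induction d arbitrary: v w)
  case 0
  then show ?case by (auto simp: words_0 divE_def diag_def)
next
  case (Suc d)
  from Suc.prems obtain a v' b w' where *: "v = a # v'" "a = 0 \<or> a = 1" "v' \<in> words d"
      "w = b # w'" "b = 0 \<or> b = 1" "w' \<in> words d"
    by (elim words_SucE)
  note IH = Suc.IH[OF *(3,6)]
  show ?case
    using *(2,5) IH *(3,6)
    by (auto simp: * sum_words_Suc divE_Cons diag_Cons divE_0 sum_endo_id)
      (auto simp: diag_def endo_id_def)
qed

section \<open>Tensor powers of unipotent and diagonal matrices\<close>

lemma tensor_power_endos: "tensor_power d g \<in> endos d"
  by (auto simp: tensor_power_def endos_def)

lemma tensor_power_Cons: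
  "a \<in> {0, 1} \<Longrightarrow> b \<in> {0, 1} \<Longrightarrow>
    tensor_power (Suc d) g (a # v) (b # w) = g a b * tensor_power d g v w"
  by (auto simp: tensor_power_def prod.lessThan_Suc_shift simp del: prod.lessThan_Suc)

lemma tensor_power_Nil: "tensor_power 0 g [] [] = 1"
  by (simp add: tensor_power_def words_0)

lemma tensor_power_mult:
  "endo_mult d (tensor_power d g) (tensor_power d h) =
   tensor_power d (\<lambda>i j. g i 0 * h 0 j + g i 1 * h 1 j)"
proof (rule endo_eqI[where d = d])
  show "endo_mult d (tensor_power d g) (tensor_power d h) v w =
      tensor_power d (\<lambda>i j. g i 0 * h 0 j + g i 1 * h 1 j) v w"
    if "v \<in> words d" "w \<in> words d" for v w
    using that
  proof (induction d arbitrary: v w)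
    case 0
    then show ?case by (auto simp: words_0 tensor_power_Nil endo_mult_def)
  next
    case (Suc d)
    from Suc.prems obtain a v' b w' where *: "v = a # v'" "a = 0 \<or> a = 1" "v' \<in> words d"
        "w = b # w'" "b = 0 \<or> b = 1" "w' \<in> words d"
      by (elim words_SucE)
    have scale: "(\<Sum>u\<in>words d. x * tensor_power d g v' u * (y * tensor_power d h u w')) =
        x * y * endo_mult d (tensor_power d g) (tensor_power d h) v' w'" for x y
      by (simp add: endo_mult_def sum_distrib_left mult_ac)
    have "endo_mult (Suc d) (tensor_power (Suc d) g) (tensor_power (Suc d) h) v w =
        (g a 0 * h 0 b + g a 1 * h 1 b) * endo_mult d (tensor_power d g) (tensor_power d h) v' w'"
      unfolding endo_mult_def[of "Suc d"] sum_words_Suc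
      using *(2,5) by (simp add: *(1,4) tensor_power_Cons scale distrib_right)
    then show ?case
      using *(2,5) by (simp add: *(1,4) tensor_power_Cons Suc.IH[OF *(3,6)])
  qed
qed (auto intro: endo_mult_endos tensor_power_endos)

lemma tensor_power_upper_entry:
  assumes "v \<in> words d" "w \<in> words d"
  shows "tensor_power d (\<lambda>i j. if i = j then 1 else if i < j then t else 0) v w =
    (if list_all2 (\<le>) v w then t ^ (sum_list w - sum_list v) else 0)"
  using assms
proof (induction d arbitrary: v w)
  case 0
  then show ?case by (auto simp: words_0 tensor_power_Nil)
next
  case (Suc d)
  from Suc.prems obtain a v' b w' where *: "v = a # v'" "a = 0 \<or> a = 1" "v' \<in> words d"
      "w = b # w'" "b = 0 \<or> b = 1" "w' \<in> words d"
    by (elim words_SucE)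
  show ?case
    using *(2,5) Suc.IH[OF *(3,6)] list_all2_le_sum_list[of v' w']
    by (auto simp: *(1,4) tensor_power_Cons Suc_diff_le)
qed

text \<open>The unipotent matrix 1 + t E_12 acts as exp(t e). Hence its operator is a polynomial in
  t whose coefficients are the divided powers.\<close>

lemma tensor_power_upper:
  "tensor_power d (\<lambda>i j. if i = j then 1 else if i < j then t else 0) =
   (\<lambda>v w. \<Sum>c\<le>d. t ^ c * divE d c v w)"
proof (rule endo_eqI[where d = d])
  show "(\<lambda>v w. \<Sum>c\<le>d. t ^ c * divE d c v w) \<in> endos d"
    by (auto simp: endos_def divE_def)
  fix v w assume vw: "v \<in> words d" "w \<in> words d"
  show "tensor_power d (\<lambda>i j. if i = j then 1 else if i < j then t else 0) v w =
      (\<Sum>c\<le>d. t ^ c * divE d c v w)"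
  proof (cases "list_all2 (\<le>) v w")
    case True
    have "(\<Sum>c\<le>d. t ^ c * divE d c v w) = (\<Sum>c\<le>d. if c = sum_list w - sum_list v then t ^ c else 0)"
      using vw True list_all2_le_sum_list[OF True] by (intro sum.cong) (auto simp: divE_def)
    also have "\<dots> = t ^ (sum_list w - sum_list v)"
      using sum_list_words_le[OF vw(2)] by simp
    finally show ?thesis using vw True by (simp add: tensor_power_upper_entry)
  next
    case False
    with vw show ?thesis by (simp add: tensor_power_upper_entry divE_def)
  qed
qed (rule tensor_power_endos)

lemma tensor_power_transp:
  "tensor_power d (\<lambda>i j. g j i) = endo_transp (tensor_power d g)"
  by (auto simp: tensor_power_def endo_transp_def fun_eq_iff)

lemma tensor_power_diagonal:
  "tensor_power d (\<lambda>i j. if i = j then if i = 0 then x else y else 0) =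
   diag d (\<lambda>k. x ^ (d - k) * y ^ k)"
proof (rule endo_eqI[where d = d])
  show "tensor_power d (\<lambda>i j. if i = j then if i = 0 then x else y else 0) v w =
      diag d (\<lambda>k. x ^ (d - k) * y ^ k) v w" if "v \<in> words d" "w \<in> words d" for v w
    using that
  proof (induction d arbitrary: v w)
    case 0
    then show ?case by (auto simp: words_0 tensor_power_Nil diag_def)
  next
    case (Suc d)
    from Suc.prems obtain a v' b w' where *: "v = a # v'" "a = 0 \<or> a = 1" "v' \<in> words d"
        "w = b # w'" "b = 0 \<or> b = 1" "w' \<in> words d"
      by (elim words_SucE)
    show ?case
      using *(2,5) *(3,6) Suc.IH[OF *(3,6)] sum_list_words_le[OF *(3)]
      by (auto simp: * tensor_power_Cons diag_def Suc_diff_le)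
  qed
qed (auto intro: tensor_power_endos diag_endos)

section \<open>Linear structure on the operators\<close>

lemma sum_fun_apply: "(\<Sum>x\<in>A. f x) y = (\<Sum>x\<in>A. f x y)"
  by (induction A rule: infinite_finite_induct) auto

interpretation endo: vector_space endo_scale
  by standard (auto simp: endo_scale_def algebra_simps fun_eq_iff)

lemma endos_subspace: "endo.subspace (endos d)"
  by (rule endo.subspaceI) (auto simp: endos_def endo_scale_def)

lemma endo_mult_add_left: "endo_mult d (L + M) N = endo_mult d L N + endo_mult d M N"
  by (simp add: endo_mult_def fun_eq_iff distrib_right sum.distrib)

lemma endo_mult_add_right: "endo_mult d L (M + N) = endo_mult d L M + endo_mult d L N"
  by (simp add: endo_mult_def fun_eq_iff distrib_left sum.distrib)

lemma endo_mult_scale_left: "endo_mult d (endo_scale c M) N = endo_scale c (endo_mult d M N)"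
  by (simp add: endo_mult_def endo_scale_def fun_eq_iff sum_distrib_left mult.assoc)

lemma endo_mult_scale_right: "endo_mult d M (endo_scale c N) = endo_scale c (endo_mult d M N)"
  by (simp add: endo_mult_def endo_scale_def fun_eq_iff sum_distrib_left mult.left_commute)

lemma endo_mult_0_left: "endo_mult d 0 M = 0"
  by (simp add: endo_mult_def fun_eq_iff)

lemma endo_mult_0_right: "endo_mult d M 0 = 0"
  by (simp add: endo_mult_def fun_eq_iff)

lemma endo_add_eq_plus: "endo_add M N = M + N"
  by (simp add: endo_add_def fun_eq_iff)

lemma span_mult_closed:
  assumes "\<And>M N. M \<in> A \<Longrightarrow> N \<in> A \<Longrightarrow> endo_mult d M N \<in> endo.span A"
    and "M \<in> endo.span A" "N \<in> endo.span A"
  shows "endo_mult d M N \<in> endo.span A"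
  using assms(2)
proof (induction M rule: endo.span_induct_alt)
  case base
  then show ?case by (simp add: endo_mult_0_left endo.span_zero del: zero_fun_apply)
next
  case (step c L M)
  have "endo_mult d L N \<in> endo.span A"
    using assms(3)
  proof (induction N rule: endo.span_induct_alt)
    case base
    then show ?case by (simp add: endo_mult_0_right endo.span_zero del: zero_fun_apply)
  next
    case (step c K N)
    with \<open>L \<in> A\<close> assms(1) show ?case
      by (simp add: endo_mult_add_right endo_mult_scale_right endo.span_add endo.span_scale del: plus_fun_apply)
  qed
  with step show ?case
    by (simp add: endo_mult_add_left endo_mult_scale_left endo.span_add endo.span_scale del: plus_fun_apply)
qed

section \<open>The Schur algebra\<close>

lemma schur_eq_span: "schur d = endo.span {tensor_power d g | g. invertible2 g}"
  unfolding schur_def endo.span_explicit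
  by (auto simp: fun_eq_iff sum_fun_apply endo_scale_def)

lemma tensor_power_in_schur: "invertible2 g \<Longrightarrow> tensor_power d g \<in> schur d"
  unfolding schur_eq_span by (rule endo.span_base) auto

lemma schur_subspace: "endo.subspace (schur d)"
  unfolding schur_eq_span by simp

lemma schur_mult:
  assumes "M \<in> schur d" "N \<in> schur d"
  shows "endo_mult d M N \<in> schur d"
  using assms unfolding schur_eq_span
proof (rule span_mult_closed[rotated])
  fix M N assume "M \<in> {tensor_power d g |g. invertible2 g}" "N \<in> {tensor_power d g |g. invertible2 g}"
  then obtain g h where *: "M = tensor_power d g" "N = tensor_power d h" "invertible2 g" "invertible2 h"
    by auto
  let ?gh = "\<lambda>i j. g i 0 * h 0 j + g i 1 * h 1 j"
  have "?gh 0 0 * ?gh 1 1 - ?gh 0 1 * ?gh 1 0 =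
      (g 0 0 * g 1 1 - g 0 1 * g 1 0) * (h 0 0 * h 1 1 - h 0 1 * h 1 0)"
    by (simp add: algebra_simps)
  with * have "invertible2 ?gh" by (simp add: invertible2_def)
  then show "endo_mult d M N \<in> endo.span {tensor_power d g |g. invertible2 g}"
    unfolding * tensor_power_mult schur_eq_span[symmetric] by (rule tensor_power_in_schur)
qed

lemma schur_transp:
  assumes "M \<in> schur d"
  shows "endo_transp M \<in> schur d"
  using assms unfolding schur_eq_span
proof (induction M rule: endo.span_induct_alt)
  case base
  have "endo_transp 0 = 0" by (simp add: endo_transp_def fun_eq_iff)
  then show ?case by (simp add: endo.span_zero del: zero_fun_apply)
next
  case (step c L M)
  then obtain g where g: "L = tensor_power d g" "invertible2 g" by auto
  then have "invertible2 (\<lambda>i j. g j i)" by (simp add: invertible2_def mult.commute)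
  then have "endo_transp L \<in> endo.span {tensor_power d g |g. invertible2 g}"
    unfolding g tensor_power_transp[symmetric] schur_eq_span[symmetric] by (rule tensor_power_in_schur)
  moreover have "endo_transp (endo_scale c L + M) = endo_scale c (endo_transp L) + endo_transp M"
    by (simp add: endo_transp_def endo_scale_def fun_eq_iff)
  ultimately show ?case using step by (simp add: endo.span_add endo.span_scale del: plus_fun_apply)
qed

section \<open>Divided powers and weight operators in the Schur algebra\<close>

lemma divE_eq_0: "d < c \<Longrightarrow> divE d c = 0"
  using sum_list_words_le by (force simp: divE_def fun_eq_iff)

text \<open>Interpolation in t at d + 1 values extracts the coefficient of t^c from the operators of
  1 + t E_12.\<close>

lemma divE_in_schur: "divE d c \<in> schur d"
proof (cases "c \<le> d")
  case True
  have inj: "inj_on (\<lambda>i. of_nat (Suc i) :: rat) {..d}" by (auto simp: inj_on_def)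
  obtain k where k: "\<And>b. b \<le> d \<Longrightarrow>
      (\<Sum>i\<le>d. k i * of_nat (Suc i) ^ b) = (if b = c then 1 else 0 :: rat)"
    by (rule dual_interpolation[OF inj, of "\<lambda>b. if b = c then 1 else 0"]) blast
  let ?U = "\<lambda>i. tensor_power d (\<lambda>p q. if p = q then 1 else if p < q then of_nat (Suc i) else 0)"
  have "(\<Sum>i\<le>d. endo_scale (k i) (?U i)) = divE d c"
  proof (intro ext)
    fix v w
    have "(\<Sum>i\<le>d. endo_scale (k i) (?U i)) v w =
        (\<Sum>i\<le>d. k i * (\<Sum>b\<le>d. of_nat (Suc i) ^ b * divE d b v w))"
      by (simp add: sum_fun_apply endo_scale_def tensor_power_upper)
    also have "\<dots> = (\<Sum>b\<le>d. (\<Sum>i\<le>d. k i * of_nat (Suc i) ^ b) * divE d b v w)"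
      unfolding sum_distrib_left sum_distrib_right by (subst sum.swap) (simp add: mult.assoc)
    also have "\<dots> = (\<Sum>b\<le>d. if b = c then divE d b v w else 0)"
      by (intro sum.cong) (auto simp: k simp del: of_nat_Suc)
    also have "\<dots> = divE d c v w" using True by simp
    finally show "(\<Sum>i\<le>d. endo_scale (k i) (?U i)) v w = divE d c v w" .
  qed
  moreover have "(\<Sum>i\<le>d. endo_scale (k i) (?U i)) \<in> schur d"
    by (intro endo.subspace_sum endo.subspace_scale schur_subspace tensor_power_in_schur)
      (simp add: invertible2_def)
  ultimately show ?thesis by simp
next
  case False
  then show ?thesis by (simp add: divE_eq_0 endo.subspace_0[OF schur_subspace])
qed

text \<open>The matrix diag(1, t) acts on weight k by t^k. A combination over d + 1 values of t
  replaces these powers by arbitrary values \<open>g k\<close>.\<close>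

lemma diag_in_schur: "diag d g \<in> schur d"
proof -
  \<comment> \<open>The nodes start at 1, because the value 0 would give a singular diagonal
    matrix.\<close>
  have inj: "inj_on (\<lambda>i. of_nat (Suc i) :: rat) {..d}" by (auto simp: inj_on_def)
  obtain k where k: "\<And>b. b \<le> d \<Longrightarrow> (\<Sum>i\<le>d. k i * of_nat (Suc i) ^ b) = g b"
    by (rule dual_interpolation[OF inj, of g]) blast
  let ?D = "\<lambda>i. tensor_power d (\<lambda>p q. if p = q then if p = 0 then 1 else of_nat (Suc i) else 0)"
  have "(\<Sum>i\<le>d. endo_scale (k i) (?D i)) = diag d g"
    unfolding tensor_power_diagonal
    by (auto simp: fun_eq_iff sum_fun_apply endo_scale_def diag_def sum_list_words_le k
        simp del: of_nat_Suc)
  moreover have "(\<Sum>i\<le>d. endo_scale (k i) (?D i)) \<in> schur d"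
    by (intro endo.subspace_sum endo.subspace_scale schur_subspace tensor_power_in_schur)
      (simp add: invertible2_def del: of_nat_Suc)
  ultimately show ?thesis by simp
qed

section \<open>Generation of the Schur algebra by divided powers and weight operators\<close>

lemma tensor_power_cong:
  assumes "\<And>i j. i \<in> {0, 1} \<Longrightarrow> j \<in> {0, 1} \<Longrightarrow> g i j = h i j"
  shows "tensor_power d g = tensor_power d h"
proof (intro ext)
  fix v w
  have "v ! i \<in> {0, 1}" if "v \<in> words d" "i < d" for v i
    using that nth_mem[of i v] unfolding words_def mem_Collect_eq by (metis subsetD)
  then have "g (v ! i) (w ! i) = h (v ! i) (w ! i)" if "v \<in> words d" "w \<in> words d" "i < d" for i
    using that by (intro assms)
  then show "tensor_power d g v w = tensor_power d h v w"
    by (auto simp: tensor_power_def intro!: prod.cong)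
qed

text \<open>Gauss decomposition, after a row operation if the upper left entry vanishes.\<close>

lemma schur_subset:
  assumes sub: "endo.subspace R"
    and mult: "\<And>M N. M \<in> R \<Longrightarrow> N \<in> R \<Longrightarrow> endo_mult d M N \<in> R"
    and E: "\<And>c. divE d c \<in> R" and F: "\<And>c. divF d c \<in> R" and D: "\<And>g. diag d g \<in> R"
  shows "schur d \<subseteq> R"
  unfolding schur_eq_span
proof (rule endo.span_minimal[OF _ sub], clarify)
  let ?U = "\<lambda>t (i :: nat) j. if i = j then 1 else if i < j then t else (0 :: rat)"
  have U: "tensor_power d (?U t) \<in> R" for t
  proof -
    have "tensor_power d (?U t) = (\<Sum>c\<le>d. endo_scale (t ^ c) (divE d c))"
      by (simp add: tensor_power_upper fun_eq_iff sum_fun_apply endo_scale_def)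
    then show ?thesis using E by (simp add: endo.subspace_sum endo.subspace_scale sub)
  qed
  have L: "tensor_power d (\<lambda>i j. ?U t j i) \<in> R" for t
  proof -
    have "tensor_power d (\<lambda>i j. ?U t j i) = (\<Sum>c\<le>d. endo_scale (t ^ c) (divF d c))"
      unfolding tensor_power_transp[of d "?U t"] tensor_power_upper
      by (simp add: endo_transp_def fun_eq_iff sum_fun_apply endo_scale_def)
    then show ?thesis using F by (simp add: endo.subspace_sum endo.subspace_scale sub)
  qed
  have gauss: "tensor_power d g \<in> R" if g0: "g 0 0 \<noteq> 0" for g
  proof -
    \<comment> \<open>The lower right entry is the determinant of g divided by
      \<open>g 0 0\<close>.\<close>
    let ?D = "\<lambda>(i :: nat) j. if i = j then if i = 0 then g 0 0 else g 1 1 - g 1 0 * g 0 1 / g 0 0 else 0"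
    let ?L = "\<lambda>i j. ?U (g 1 0 / g 0 0) j i"
    have "endo_mult d (endo_mult d (tensor_power d ?L) (tensor_power d ?D))
        (tensor_power d (?U (g 0 1 / g 0 0))) \<in> R"
      using D by (intro mult L U) (simp add: tensor_power_diagonal)
    also have "endo_mult d (endo_mult d (tensor_power d ?L) (tensor_power d ?D))
        (tensor_power d (?U (g 0 1 / g 0 0))) = tensor_power d g"
      unfolding tensor_power_mult
    proof (rule tensor_power_cong)
      fix i j :: nat
      assume "i \<in> {0, 1}" "j \<in> {0, 1}"
      then consider "i = 0" "j = 0" | "i = 0" "j = 1" | "i = 1" "j = 0" | "i = 1" "j = 1" by auto
      then show "(?L i 0 * ?D 0 0 + ?L i 1 * ?D 1 0) * ?U (g 0 1 / g 0 0) 0 j +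
          (?L i 0 * ?D 0 1 + ?L i 1 * ?D 1 1) * ?U (g 0 1 / g 0 0) 1 j = g i j"
        by cases (simp_all add: g0)
    qed
    finally show ?thesis .
  qed
  fix g assume inv: "invertible2 g"
  show "tensor_power d g \<in> R"
  proof (cases "g 0 0 = 0")
    case True
    \<comment> \<open>The second row is added to the first. The new upper left entry is
      \<open>g 1 0\<close>, which is nonzero because the determinant is
      \<open>- g 0 1 * g 1 0\<close>.\<close>
    let ?h = "\<lambda>i j. ?U 1 i 0 * g 0 j + ?U 1 i 1 * g 1 j"
    have "tensor_power d ?h \<in> R"
      using inv True by (intro gauss) (simp add: invertible2_def)
    then have "endo_mult d (tensor_power d (?U (- 1))) (tensor_power d ?h) \<in> R"
      by (intro mult U)
    also have "endo_mult d (tensor_power d (?U (- 1))) (tensor_power d ?h) = tensor_power d g"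
      unfolding tensor_power_mult by (rule tensor_power_cong) auto
    finally show ?thesis .
  qed (rule gauss)
qed

section \<open>The free algebra and its representation\<close>

interpretation fa: vector_space fa_scale
  by standard (auto simp: fa_scale_def algebra_simps fun_eq_iff)

definition fa_word :: "gen list \<Rightarrow> fa" where
  "fa_word u = (\<lambda>w. if w = u then 1 else 0)"

lemma FA_eq_span: "FA = fa.span (range fa_word)"
proof
  show "FA \<subseteq> fa.span (range fa_word)"
  proof
    fix p assume "p \<in> FA"
    then have fin: "finite {w. p w \<noteq> 0}" by (simp add: FA_def)
    have "p = (\<Sum>u | p u \<noteq> 0. fa_scale (p u) (fa_word u))"
      using fin by (auto simp: fun_eq_iff sum_fun_apply fa_scale_def fa_word_def
          if_distrib[of "(*) _"] cong: if_cong)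
    also have "\<dots> \<in> fa.span (range fa_word)"
      by (intro fa.span_sum fa.span_scale fa.span_base) auto
    finally show "p \<in> fa.span (range fa_word)" .
  qed
  have "fa.subspace FA"
  proof (rule fa.subspaceI)
    show "p + q \<in> FA" if "p \<in> FA" "q \<in> FA" for p q
    proof -
      have "{w. (p + q) w \<noteq> 0} \<subseteq> {w. p w \<noteq> 0} \<union> {w. q w \<noteq> 0}" by auto
      with that show ?thesis unfolding FA_def by (auto intro: finite_subset)
    qed
    show "fa_scale c p \<in> FA" if "p \<in> FA" for c p
      using that by (auto simp: FA_def fa_scale_def elim: rev_finite_subset)
  qed (simp add: FA_def)
  moreover have "range fa_word \<subseteq> FA" by (auto simp: FA_def fa_word_def)
  ultimately show "fa.span (range fa_word) \<subseteq> FA" by (rule fa.span_minimal[rotated])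
qed

lemma FA_subspace: "fa.subspace FA"
  unfolding FA_eq_span by simp

lemma fa_word_FA: "fa_word u \<in> FA"
  unfolding FA_eq_span by (simp add: fa.span_base)

lemma FA_induct [consumes 1, case_names zero step]:
  assumes "p \<in> FA" "P 0"
    and step: "\<And>c u q. q \<in> FA \<Longrightarrow> P q \<Longrightarrow> P (fa_scale c (fa_word u) + q)"
  shows "P p"
proof -
  have "p \<in> FA \<and> P p"
    using assms(1) unfolding FA_eq_span
  proof (induction p rule: fa.span_induct_alt)
    case base
    with assms(2) show ?case by (simp add: fa.span_zero del: zero_fun_apply)
  next
    case (step c p q)
    then show ?case
      using assms(3) by (auto simp: FA_eq_span simp del: plus_fun_apply
          intro: fa.span_add fa.span_scale fa.span_base)
  qed
  then show ?thesis ..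
qed

lemma fa_add_eq_plus: "fa_add p q = p + q"
  by (simp add: fa_add_def fun_eq_iff)

lemma fa_sub_eq_minus: "fa_sub p q = p - q"
  by (simp add: fa_sub_def fun_eq_iff)

lemma fa_zero_eq_0: "fa_zero = 0"
  by (simp add: fa_zero_def fun_eq_iff)

lemma fa_mult_add_left: "fa_mult (p + q) r = fa_mult p r + fa_mult q r"
  by (simp add: fa_mult_def fun_eq_iff distrib_right sum.distrib)

lemma fa_mult_add_right: "fa_mult p (q + r) = fa_mult p q + fa_mult p r"
  by (simp add: fa_mult_def fun_eq_iff distrib_left sum.distrib)

lemma fa_mult_scale_left: "fa_mult (fa_scale c p) q = fa_scale c (fa_mult p q)"
  by (simp add: fa_mult_def fa_scale_def fun_eq_iff sum_distrib_left mult.assoc)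

lemma fa_mult_scale_right: "fa_mult p (fa_scale c q) = fa_scale c (fa_mult p q)"
  by (simp add: fa_mult_def fa_scale_def fun_eq_iff sum_distrib_left mult.left_commute)

lemma fa_mult_0_left: "fa_mult 0 p = 0"
  by (simp add: fa_mult_def fun_eq_iff)

lemma fa_mult_0_right: "fa_mult p 0 = 0"
  by (simp add: fa_mult_def fun_eq_iff)

lemma fa_mult_diff_left: "fa_mult (p - q) r = fa_mult p r - fa_mult q r"
  by (simp add: fa_mult_def fun_eq_iff left_diff_distrib sum_subtractf)

lemma fa_mult_diff_right: "fa_mult p (q - r) = fa_mult p q - fa_mult p r"
  by (simp add: fa_mult_def fun_eq_iff right_diff_distrib sum_subtractf)

lemma fa_mult_word: "fa_mult (fa_word u) (fa_word v) = fa_word (u @ v)"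
proof
  fix w
  have split: "take i w = u \<and> drop i w = v \<longleftrightarrow> i = length u \<and> w = u @ v" if "i \<le> length w" for i
    using that by (metis append_eq_conv_conj append_take_drop_id length_take min.absorb2)
  have "fa_mult (fa_word u) (fa_word v) w =
      (\<Sum>i\<le>length w. if i = length u then if w = u @ v then 1 else 0 else 0)"
    unfolding fa_mult_def fa_word_def
  proof (intro sum.cong refl)
    fix i assume "i \<in> {..length w}"
    with split[of i] show "(if take i w = u then 1 else 0) * (if drop i w = v then 1 else 0) =
        (if i = length u then if w = u @ v then 1 else 0 else (0 :: rat))"
      by (cases "take i w = u"; cases "drop i w = v"; simp; blast)
  qed
  also have "\<dots> = fa_word (u @ v) w" by (auto simp: fa_word_def)
  finally show "fa_mult (fa_word u) (fa_word v) w = fa_word (u @ v) w" .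
qed

lemma fa_one_eq_word: "fa_one = fa_word []"
  by (simp add: fa_one_def fa_word_def)

lemma fa_gen_eq_word: "fa_gen x = fa_word [x]"
  by (simp add: fa_gen_def fa_word_def)

lemma fa_pow_gen: "fa_pow (fa_gen x) n = fa_word (replicate n x)"
  by (induction n) (simp_all add: fa_one_eq_word fa_gen_eq_word fa_mult_word replicate_append_same)

lemma FA_mult:
  assumes "p \<in> FA" "q \<in> FA"
  shows "fa_mult p q \<in> FA"
  using assms(1)
proof (induction p rule: FA_induct)
  case zero
  then show ?case by (simp add: fa_mult_0_left fa.subspace_0[OF FA_subspace] del: zero_fun_apply)
next
  case (step c u r)
  have "fa_mult (fa_word u) q \<in> FA"
    using assms(2)
  proof (induction q rule: FA_induct)
    case zero
    then show ?case by (simp add: fa_mult_0_right fa.subspace_0[OF FA_subspace] del: zero_fun_apply)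
  next
    case (step c v r)
    then show ?case
      by (simp add: fa_mult_add_right fa_mult_scale_right fa_mult_word fa_word_FA
          fa.subspace_add fa.subspace_scale FA_subspace del: plus_fun_apply)
  qed
  with step show ?case
    by (simp add: fa_mult_add_left fa_mult_scale_left
        fa.subspace_add fa.subspace_scale FA_subspace del: plus_fun_apply)
qed

section \<open>The representation of the free algebra\<close>

primrec gen_op :: "nat \<Rightarrow> gen \<Rightarrow> endo" where
  "gen_op d Ge = divE d 1"
| "gen_op d Gf = divF d 1"
| "gen_op d Gh = diag d of_nat"

definition word_op :: "nat \<Rightarrow> gen list \<Rightarrow> endo" where
  "word_op d w = foldr (\<lambda>x. endo_mult d (gen_op d x)) w (endo_id d)"

definition rep :: "nat \<Rightarrow> fa \<Rightarrow> endo" where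
  "rep d p = (\<Sum>w | p w \<noteq> 0. endo_scale (p w) (word_op d w))"

lemma gen_op_endos: "gen_op d x \<in> endos d"
  by (cases x) (simp_all add: divE_endos diag_endos endo_transp_endos)

lemma word_op_endos: "word_op d w \<in> endos d"
  by (induction w)
    (simp_all add: word_op_def endo_id_eq_diag diag_endos endo_mult_endos gen_op_endos)

lemma word_op_Nil: "word_op d [] = endo_id d"
  by (simp add: word_op_def)

lemma word_op_Cons: "word_op d (x # w) = endo_mult d (gen_op d x) (word_op d w)"
  by (simp add: word_op_def)

lemma word_op_append: "word_op d (u @ v) = endo_mult d (word_op d u) (word_op d v)"
  by (induction u)
    (simp_all add: word_op_Nil word_op_Cons endo_mult_id_left word_op_endos endo_mult_assoc)

text \<open>Multiplying the c-th divided power by e produces the binomial coefficient c + 1, so the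
  factors accumulate to c!.\<close>

lemma word_op_replicate_E: "word_op d (replicate c Ge) = endo_scale (fact c) (divE d c)"
proof (induction c)
  case 0
  then show ?case by (simp add: word_op_Nil divE_0)
next
  case (Suc c)
  then show ?case
    by (simp add: word_op_Cons endo_mult_scale_right divE_mult mult.commute)
qed

lemma word_op_replicate_F: "word_op d (replicate c Gf) = endo_scale (fact c) (divF d c)"
proof (induction c)
  case 0
  then show ?case by (auto simp: word_op_Nil divE_0 endo_transp_def endo_id_def fun_eq_iff endo_scale_def)
next
  case (Suc c)
  have "endo_transp (endo_scale x M) = endo_scale x (endo_transp M)" for x M
    by (simp add: endo_transp_def endo_scale_def)
  with Suc show ?case
    by (simp add: word_op_Cons endo_mult_scale_right endo_mult_transp divE_mult mult.commute)
qed

lemma word_op_replicate_H: "word_op d (replicate b Gh) = diag d (\<lambda>k. of_nat k ^ b)"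
  by (induction b) (auto simp: word_op_Nil endo_id_eq_diag word_op_Cons endo_mult_diag_left diag_endos,
      auto simp: diag_def fun_eq_iff)

text \<open>Replaces the support by a larger finite set, so that polynomials with different supports
  can be compared over one index set.\<close>

lemma rep_eq_sum:
  assumes "finite S" "{w. p w \<noteq> 0} \<subseteq> S"
  shows "rep d p = (\<Sum>w\<in>S. endo_scale (p w) (word_op d w))"
  unfolding rep_def using assms by (intro sum.mono_neutral_left) auto

lemma rep_word: "rep d (fa_word w) = word_op d w"
  by (subst rep_eq_sum[where S = "{w}"]) (auto simp: fa_word_def)

lemma rep_0: "rep d 0 = 0"
  by (simp add: rep_def)

lemma rep_add:
  assumes "p \<in> FA" "q \<in> FA"
  shows "rep d (p + q) = rep d p + rep d q"
proof -
  let ?S = "{w. p w \<noteq> 0} \<union> {w. q w \<noteq> 0}"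
  have fin: "finite ?S" using assms by (simp add: FA_def)
  show ?thesis
    by (subst (1 2 3) rep_eq_sum[OF fin]) (auto simp: endo.scale_left_distrib sum.distrib)
qed

lemma rep_scale:
  assumes "p \<in> FA"
  shows "rep d (fa_scale c p) = endo_scale c (rep d p)"
proof -
  have fin: "finite {w. p w \<noteq> 0}" using assms by (simp add: FA_def)
  show ?thesis
    by (subst (1 2) rep_eq_sum[OF fin]) (auto simp: fa_scale_def endo.scale_sum_right)
qed

lemma rep_mult:
  assumes "p \<in> FA" "q \<in> FA"
  shows "rep d (fa_mult p q) = endo_mult d (rep d p) (rep d q)"
  using assms(1)
proof (induction p rule: FA_induct)
  case zero
  then show ?case by (simp add: fa_mult_0_left rep_0 endo_mult_0_left del: zero_fun_apply)
next
  case (step c u r)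
  have "rep d (fa_mult (fa_word u) q) = endo_mult d (word_op d u) (rep d q)"
    using assms(2)
  proof (induction q rule: FA_induct)
    case zero
    then show ?case by (simp add: fa_mult_0_right rep_0 endo_mult_0_right del: zero_fun_apply)
  next
    case (step c v r)
    then show ?case
      by (simp add: fa_mult_add_right fa_mult_scale_right fa_mult_word rep_add rep_scale rep_word
          word_op_append endo_mult_add_right endo_mult_scale_right fa.subspace_scale[OF FA_subspace]
          fa_word_FA FA_mult del: plus_fun_apply)
  qed
  with step show ?case
    by (simp add: fa_mult_add_left fa_mult_scale_left rep_add rep_scale rep_word assms(2)
        endo_mult_add_left endo_mult_scale_left fa.subspace_scale[OF FA_subspace] fa_word_FA FA_mult
        del: plus_fun_apply)
qed

lemma rep_endos: "rep d p \<in> endos d"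
  unfolding rep_def
  by (intro endo.subspace_sum endo.subspace_scale endos_subspace word_op_endos)

lemma alg_hom_rep: "alg_hom d (rep d)"
  by (auto simp: alg_hom_def rep_endos fa_one_eq_word rep_word word_op_Nil fa_add_eq_plus
      endo_add_eq_plus rep_add rep_scale rep_mult)

section \<open>The image of the representation\<close>

lemma rep_range_subspace: "endo.subspace (rep d ` FA)"
proof (rule endo.subspaceI)
  show "0 \<in> rep d ` FA"
    by (rule image_eqI[of _ _ 0]) (simp_all add: rep_0 fa.subspace_0[OF FA_subspace])
  show "M + N \<in> rep d ` FA" if "M \<in> rep d ` FA" "N \<in> rep d ` FA" for M N
    using that fa.subspace_add[OF FA_subspace] by (auto simp flip: rep_add)
  show "endo_scale c M \<in> rep d ` FA" if "M \<in> rep d ` FA" for c M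
    using that fa.subspace_scale[OF FA_subspace] by (auto simp flip: rep_scale)
qed

text \<open>The generators act by elements of the Schur algebra, which gives one inclusion.
  Conversely, the image contains the divided powers, since c! is invertible in the rationals, and
  all functions of the weight.\<close>

lemma rep_range: "rep d ` FA = schur d"
proof
  have "gen_op d x \<in> schur d" for x
    by (cases x) (simp_all add: divE_in_schur diag_in_schur schur_transp)
  then have "word_op d w \<in> schur d" for w
    by (induction w) (simp_all add: word_op_Nil word_op_Cons schur_mult endo_id_eq_diag diag_in_schur)
  then show "rep d ` FA \<subseteq> schur d"
    unfolding rep_def by (auto intro!: endo.subspace_sum endo.subspace_scale schur_subspace)
next
  have word: "word_op d w \<in> rep d ` FA" for w
    using rep_word fa_word_FA by (metis image_eqI)
  note sub = rep_range_subspace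
  have unscale: "M \<in> rep d ` FA" if "endo_scale c M \<in> rep d ` FA" "c \<noteq> 0" for c M
    using endo.subspace_scale[OF sub that(1), of "inverse c"] that(2) by simp
  show "schur d \<subseteq> rep d ` FA"
  proof (rule schur_subset[OF sub])
    show "endo_mult d M N \<in> rep d ` FA" if "M \<in> rep d ` FA" "N \<in> rep d ` FA" for M N
      using that FA_mult by (auto simp flip: rep_mult)
    show "divE d c \<in> rep d ` FA" for c
      using word[of "replicate c Ge"] unfolding word_op_replicate_E by (rule unscale) simp
    show "divF d c \<in> rep d ` FA" for c
      using word[of "replicate c Gf"] unfolding word_op_replicate_F by (rule unscale) simp
    show "diag d g \<in> rep d ` FA" for g
    proof -
      have inj: "inj_on (of_nat :: nat \<Rightarrow> rat) {..d}" by (auto simp: inj_on_def)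
      \<comment> \<open>Weights take only the values 0 to d, so every function of the weight is a
        polynomial in H.\<close>
      obtain p where p: "degree p \<le> d" "\<And>i. i \<le> d \<Longrightarrow> poly p (of_nat i) = g i"
        by (rule interpolation[OF inj, of g]) blast
      have "diag d g = (\<Sum>b\<le>degree p. endo_scale (coeff p b) (word_op d (replicate b Gh)))"
        by (auto simp: word_op_replicate_H fun_eq_iff sum_fun_apply endo_scale_def diag_def
            sum_list_words_le simp flip: p(2) poly_altdef)
      then show ?thesis by (simp add: endo.subspace_sum endo.subspace_scale sub word)
    qed
  qed
qed

section \<open>Independence of the monomials\<close>

lemma rep_diff: "p \<in> FA \<Longrightarrow> q \<in> FA \<Longrightarrow> rep d (p - q) = rep d p - rep d q"
  using rep_add[of p "fa_scale (- 1) q" d] fa.subspace_scale[OF FA_subspace, of q "- 1"]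
    rep_scale[of q d "- 1"]
  by simp

lemma FA_diff: "p \<in> FA \<Longrightarrow> q \<in> FA \<Longrightarrow> p - q \<in> FA"
  by (rule fa.subspace_diff[OF FA_subspace])

lemma FA_scale: "p \<in> FA \<Longrightarrow> fa_scale c p \<in> FA"
  by (rule fa.subspace_scale[OF FA_subspace])

lemma FA_add: "p \<in> FA \<Longrightarrow> q \<in> FA \<Longrightarrow> p + q \<in> FA"
  by (rule fa.subspace_add[OF FA_subspace])

lemma FA_sum: "(\<And>x. x \<in> A \<Longrightarrow> f x \<in> FA) \<Longrightarrow> sum f A \<in> FA"
  by (rule fa.subspace_sum[OF FA_subspace])

section \<open>The relations hold on the tensor power\<close>

lemma hprod_FA: "hprod k \<in> FA"
  by (induction k) (simp_all add: fa_gen_eq_word fa_one_eq_word fa_word_FA FA_mult FA_diff FA_scale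
      fa_sub_eq_minus)

lemma rep_gen: "rep d (fa_gen x) = gen_op d x"
  by (simp add: fa_gen_eq_word rep_word word_op_Cons word_op_Nil endo_mult_id_right gen_op_endos)

lemma rep_one: "rep d fa_one = endo_id d"
  by (simp add: fa_one_eq_word rep_word word_op_Nil)

lemma fa_gen_FA: "fa_gen x \<in> FA"
  by (simp add: fa_gen_eq_word fa_word_FA)

lemma fa_one_FA: "fa_one \<in> FA"
  by (simp add: fa_one_eq_word fa_word_FA)

lemmas FA_closed = FA_mult FA_add FA_diff FA_scale fa_gen_FA fa_one_FA fa_word_FA hprod_FA

lemma rep_hprod: "rep d (hprod k) = diag d (\<lambda>m. \<Prod>i\<le>k. of_nat m - of_nat i)"
proof (induction k)
  case 0
  then show ?case by (simp add: rep_gen)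
next
  case (Suc k)
  have "rep d (fa_sub gH (fa_scale (of_nat (Suc k)) fa_one)) =
      diag d (\<lambda>m. of_nat m - of_nat (Suc k))"
    by (auto simp: fa_sub_eq_minus rep_diff FA_closed rep_scale rep_gen rep_one fun_eq_iff
        diag_def endo_id_eq_diag endo_scale_def simp del: of_nat_Suc)
  with Suc show ?case
    by (simp add: rep_mult FA_closed fa_sub_eq_minus endo_mult_diag_left diag_endos)
      (auto simp: diag_def fun_eq_iff)
qed

lemma relations_kernel:
  assumes "r \<in> relations d"
  shows "r \<in> FA \<and> rep d r = 0"
proof
  show "r \<in> FA"
    using assms by (auto simp: relations_def fa_sub_eq_minus FA_closed)
  \<comment> \<open>The operator e lowers the weight by exactly one. Both brackets with H follow
    from this, the one with f by exchanging the two indices.\<close>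
  have E: "divE d 1 v w \<noteq> 0 \<Longrightarrow> sum_list w = Suc (sum_list v)" for v w
    by (simp add: divE_def split: if_splits)
  have HE: "endo_mult d (diag d of_nat) (divE d 1) - endo_mult d (divE d 1) (diag d of_nat) =
      endo_scale (- 1) (divE d 1)"
  proof (intro ext)
    fix v w
    show "(endo_mult d (diag d of_nat) (divE d 1) - endo_mult d (divE d 1) (diag d of_nat)) v w =
        endo_scale (- 1) (divE d 1) v w"
      using E[of v w] by (cases "divE d 1 v w = 0")
        (simp_all add: endo_mult_diag_left endo_mult_diag_right divE_endos endo_scale_def algebra_simps)
  qed
  have HF: "endo_mult d (diag d of_nat) (divF d 1) - endo_mult d (divF d 1) (diag d of_nat) = divF d 1"
  proof (intro ext)
    fix v w
    show "(endo_mult d (diag d of_nat) (divF d 1) - endo_mult d (divF d 1) (diag d of_nat)) v w =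
        divF d 1 v w"
      using E[of w v]
      by (cases "divE d 1 w v = 0";
          simp add: endo_mult_diag_left endo_mult_diag_right divE_endos endo_transp_endos;
          simp add: endo_transp_def algebra_simps)
  qed
  have EF: "endo_mult d (divE d 1) (divF d 1) - endo_mult d (divF d 1) (divE d 1) =
      diag d (\<lambda>k. of_nat d - 2 * of_nat k)"
  proof (rule endo_eqI[where d = d])
    show "endo_mult d (divE d 1) (divF d 1) - endo_mult d (divF d 1) (divE d 1) \<in> endos d"
      by (intro endo.subspace_diff[OF endos_subspace] endo_mult_endos divE_endos endo_transp_endos)
    show "(endo_mult d (divE d 1) (divF d 1) - endo_mult d (divF d 1) (divE d 1)) v w =
        diag d (\<lambda>k. of_nat d - 2 * of_nat k) v w" if "v \<in> words d" "w \<in> words d" for v w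
      using commutator_entry[OF that] by (simp add: endo_mult_def endo_transp_def)
  qed (rule diag_endos)
  have D: "diag d (\<lambda>k. of_nat d - 2 * of_nat k) =
      endo_scale (of_nat d) (endo_id d) - endo_scale 2 (diag d of_nat)"
    by (auto simp: diag_def endo_id_def endo_scale_def fun_eq_iff)
  \<comment> \<open>The weight of a word is at most d, so one of the factors vanishes.\<close>
  have H: "diag d (\<lambda>m. \<Prod>i\<le>d. of_nat m - of_nat i) = 0"
    by (auto simp: diag_def fun_eq_iff dest: sum_list_words_le)
  show "rep d r = 0"
    using assms unfolding relations_def
    by (auto simp: fa_sub_eq_minus rep_diff rep_add FA_closed rep_mult rep_scale rep_gen rep_one rep_hprod
        HE[unfolded One_nat_def] HF[unfolded One_nat_def] EF[unfolded One_nat_def] D H)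
qed

lemma rel_ideal_kernel: "p \<in> rel_ideal d \<Longrightarrow> p \<in> FA \<and> rep d p = 0"
proof (induction rule: rel_ideal.induct)
  case zero
  then show ?case by (simp add: fa_zero_eq_0 fa.subspace_0[OF FA_subspace] rep_0 del: zero_fun_apply)
next
  case (rel r)
  then show ?case by (rule relations_kernel)
qed (simp_all add: fa_add_eq_plus FA_closed rep_add rep_scale rep_mult endo_mult_0_left endo_mult_0_right
    del: plus_fun_apply zero_fun_apply)

section \<open>Matrix entries of the monomials\<close>

lemma monom_eq_word: "Defs.monom (a, b, c) = fa_word (replicate a Gf @ replicate b Gh @ replicate c Ge)"
  by (simp add: Defs.monom_def fa_pow_gen fa_mult_word)

text \<open>Sum over intermediate words u: e^c lowers w to u, H^b multiplies by a power of the
  weight of u, and f^a raises u to v. The factorials convert powers into divided powers.\<close>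

lemma rep_monom_entry:
  "rep d (Defs.monom (a, b, c)) v w =
    fact a * fact c * (\<Sum>u\<in>words d. divE d a u v * of_nat (sum_list u) ^ b * divE d c u w)"
proof -
  have "rep d (Defs.monom (a, b, c)) = endo_scale (fact a * fact c)
      (endo_mult d (divF d a) (\<lambda>v w. of_nat (sum_list v) ^ b * divE d c v w))"
    by (simp add: monom_eq_word rep_word word_op_append word_op_replicate_F word_op_replicate_H
        word_op_replicate_E endo_mult_scale_left endo_mult_scale_right endo_mult_diag_left divE_endos
        mult.commute)
  then show ?thesis
    by (simp add: endo_scale_def endo_mult_def endo_transp_def mult.assoc)
qed

lemma finite_monom_idx: "finite (monom_idx d)"
  by (rule finite_subset[of _ "{..d} \<times> {..d} \<times> {..d}"]) (auto simp: monom_idx_def)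

lemma lin_comb_eq_sum: "lin_comb d k = (\<Sum>m\<in>monom_idx d. fa_scale (k m) (Defs.monom m))"
  by (simp add: lin_comb_def fun_eq_iff sum_fun_apply fa_scale_def)

lemma monom_FA: "Defs.monom m \<in> FA"
  by (cases m) (simp add: monom_eq_word fa_word_FA)

lemma rep_sum:
  assumes "\<And>x. x \<in> A \<Longrightarrow> f x \<in> FA"
  shows "rep d (sum f A) = (\<Sum>x\<in>A. rep d (f x))"
  using assms
  by (induction A rule: infinite_finite_induct)
    (simp_all add: rep_0 rep_add FA_sum del: plus_fun_apply)

lemma rep_lin_comb_entry:
  "rep d (lin_comb d k) v w = (\<Sum>m\<in>monom_idx d. k m * rep d (Defs.monom m) v w)"
  by (simp add: lin_comb_eq_sum rep_sum monom_FA FA_scale rep_scale sum_fun_apply endo_scale_def)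

lemma list_all2_le_map2_min:
  "list_all2 (\<le>) u v \<Longrightarrow> list_all2 (\<le>) u w \<Longrightarrow> list_all2 (\<le>) u (map2 min v (w :: nat list))"
  by (auto simp: list_all2_conv_all_nth)

text \<open>A word u contributes to the entry at (v, w) only if it lies below the meet x of v and w, that
  is, if at least p ones of v and q ones of w are removed; equality forces u = x.\<close>

lemma rep_monom_triangular:
  fixes p q r s :: nat
  defines "v \<equiv> replicate p 1 @ replicate q 0 @ replicate r 1 @ replicate s 0"
    and "w \<equiv> replicate p 0 @ replicate q 1 @ replicate r 1 @ replicate s 0"
  assumes d: "p + q + r + s = d"
  shows "a < p \<or> c < q \<Longrightarrow> rep d (Defs.monom (a, b, c)) v w = 0"
    and "rep d (Defs.monom (p, b, q)) v w = fact p * fact q * of_nat r ^ b"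
proof -
  define x :: "nat list" where "x = replicate p 0 @ replicate q 0 @ replicate r 1 @ replicate s 0"
  have min: "map2 min v w = x"
    by (simp add: v_def w_def x_def)
  have words: "v \<in> words d" "w \<in> words d" "x \<in> words d"
    using d by (auto simp: words_def v_def w_def x_def)
  have sums: "sum_list v = p + r" "sum_list w = q + r" "sum_list x = r"
    by (simp_all add: v_def w_def x_def sum_list_replicate)
  have le: "list_all2 (\<le>) x v" "list_all2 (\<le>) x w"
    by (simp_all add: v_def w_def x_def list_all2_appendI list_all2_conv_all_nth nth_append)
  have below: "sum_list u \<le> r" "sum_list u = r \<Longrightarrow> u = x"
    if "list_all2 (\<le>) u v" "list_all2 (\<le>) u w" for u
    using list_all2_le_map2_min[OF that] list_all2_le_sum_list[of u x]
      list_all2_le_antisym_sum[of u x] sums(3) unfolding min by auto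
  show "rep d (Defs.monom (a, b, c)) v w = 0" if "a < p \<or> c < q"
  proof -
    have "divE d a u v * of_nat (sum_list u) ^ b * divE d c u w = 0" for u
      using below(1)[of u] that sums by (auto simp: divE_def)
    then show ?thesis unfolding rep_monom_entry by (simp only: sum.neutral_const mult_zero_right)
  qed
  have "(\<Sum>u\<in>words d. divE d p u v * of_nat (sum_list u) ^ b * divE d q u w) =
      (\<Sum>u\<in>words d. if u = x then of_nat r ^ b else 0)"
  proof (intro sum.cong refl)
    fix u assume "u \<in> words d"
    show "divE d p u v * of_nat (sum_list u) ^ b * divE d q u w = (if u = x then of_nat r ^ b else 0)"
    proof (cases "u = x")
      case True
      then show ?thesis using words le sums by (simp add: divE_def)
    next
      case False
      then show ?thesis using below(2)[of u] sums by (auto simp: divE_def)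
    qed
  qed
  then show "rep d (Defs.monom (p, b, q)) v w = fact p * fact q * of_nat r ^ b"
    using words(3) by (simp add: rep_monom_entry)
qed

text \<open>Descending induction on p + q. Suitable entries of the vanishing combination show that
  the polynomial with coefficients \<open>k (p, j, q)\<close>, of degree at most n = d - (p + q),
  vanishes at 0, ..., n.\<close>

lemma monom_independent:
  assumes "rep d (lin_comb d k) = 0" "(p, b, q) \<in> monom_idx d"
  shows "k (p, b, q) = 0"
  using assms(2)
proof (induction "d - (p + q)" arbitrary: p b q rule: less_induct)
  case less
  define n where "n = d - (p + q)"
  have pq: "p + q \<le> d" "b \<le> n" using less.prems by (auto simp: monom_idx_def n_def)
  have root: "(\<Sum>j\<le>n. k (p, j, q) * of_nat r ^ j) = 0" if "r \<le> n" for r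
  proof -
    define s where "s = n - r"
    have d: "p + q + r + s = d" using that pq by (simp add: s_def n_def)
    let ?v = "replicate p 1 @ replicate q 0 @ replicate r 1 @ replicate s 0"
    let ?w = "replicate p 0 @ replicate q 1 @ replicate r 1 @ replicate s 0"
    let ?T = "\<lambda>m. k m * rep d (Defs.monom m) ?v ?w"
    let ?J = "(\<lambda>j. (p, j, q)) ` {..n}"
    have "0 = (\<Sum>m\<in>monom_idx d. ?T m)"
      using assms(1) by (simp flip: rep_lin_comb_entry)
    also have "\<dots> = (\<Sum>m\<in>?J. ?T m)"
    proof (intro sum.mono_neutral_right finite_monom_idx ballI)
      show "?J \<subseteq> monom_idx d" using pq by (auto simp: monom_idx_def n_def)
      fix m assume m: "m \<in> monom_idx d - ?J"
      obtain a j c where abc: "m = (a, j, c)" by (cases m)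
      have "(a, c) \<noteq> (p, q)"
        using m by (auto simp: abc monom_idx_def n_def image_iff)
      \<comment> \<open>If a is at least p and c at least q, the pair (a, c) differing from (p, q)
        has a larger sum. The first case is killed by triangularity, the second by the induction
        hypothesis.\<close>
      then consider "a < p \<or> c < q" | "p + q < a + c" by fastforce
      then show "?T m = 0"
      proof cases
        case 1
        then show ?thesis using rep_monom_triangular(1)[OF d 1, of j] by (simp add: abc)
      next
        case 2
        have "k (a, j, c) = 0"
          using m 2 by (intro less.hyps) (auto simp: abc monom_idx_def)
        then show ?thesis by (simp add: abc)
      qed
    qed
    also have "\<dots> = fact p * fact q * (\<Sum>j\<le>n. k (p, j, q) * of_nat r ^ j)"
      by (subst sum.reindex)
        (auto simp: inj_on_def rep_monom_triangular(2)[OF d] sum_distrib_left intro!: sum.cong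
          simp del: One_nat_def)
    finally show ?thesis by simp
  qed
  have inj: "inj_on (of_nat :: nat \<Rightarrow> rat) {..n}" by (auto simp: inj_on_def)
  \<comment> \<open>A combination of evaluations at 0, ..., n that reads off the coefficient of
    degree b.\<close>
  obtain c where c: "\<And>j. j \<le> n \<Longrightarrow> (\<Sum>r\<le>n. c r * of_nat r ^ j) = (if j = b then 1 else 0 :: rat)"
    by (rule dual_interpolation[OF inj, of "\<lambda>j. if j = b then 1 else 0"]) blast
  have "k (p, b, q) = (\<Sum>j\<le>n. k (p, j, q) * (\<Sum>r\<le>n. c r * of_nat r ^ j))"
    using pq(2) by (simp add: c if_distrib[of "(*) _"] cong: if_cong)
  also have "\<dots> = (\<Sum>r\<le>n. c r * (\<Sum>j\<le>n. k (p, j, q) * of_nat r ^ j))"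
    unfolding sum_distrib_left by (subst sum.swap) (simp add: mult.left_commute)
  also have "\<dots> = 0" by (simp add: root)
  finally show ?case .
qed

section \<open>Spanning by the monomials\<close>

lemma rel_ideal_subspace: "fa.subspace (rel_ideal d)"
  using rel_ideal.zero rel_ideal.add rel_ideal.scale
  by (intro fa.subspaceI) (simp_all add: fa_zero_eq_0 fa_add_eq_plus del: zero_fun_apply plus_fun_apply)

text \<open>The preimage in the free algebra of the length filtration on the quotient. Membership of
  p - q in \<open>filt d n\<close> expresses congruence modulo the relations and words of length at
  most n.\<close>

definition filt :: "nat \<Rightarrow> nat \<Rightarrow> fa set" where
  "filt d n = fa.span (fa_word ` {w. length w \<le> n} \<union> rel_ideal d)"

lemma filt_subspace: "fa.subspace (filt d n)"
  by (simp add: filt_def)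

lemmas filt_closed = fa.subspace_add[OF filt_subspace] fa.subspace_diff[OF filt_subspace]
  fa.subspace_scale[OF filt_subspace] fa.subspace_neg[OF filt_subspace] fa.subspace_0[OF filt_subspace]

lemma filt_word: "length w \<le> n \<Longrightarrow> fa_word w \<in> filt d n"
  unfolding filt_def by (rule fa.span_base) auto

lemma rel_ideal_filt: "p \<in> rel_ideal d \<Longrightarrow> p \<in> filt d n"
  unfolding filt_def by (rule fa.span_base) auto

lemma filt_mono: "m \<le> n \<Longrightarrow> filt d m \<subseteq> filt d n"
  unfolding filt_def by (rule fa.span_mono) auto

lemma filt_diff_sym: "p - q \<in> filt d n \<Longrightarrow> q - p \<in> filt d n"
  using filt_closed(4) by fastforce

lemma filt_diff_trans: "p - q \<in> filt d n \<Longrightarrow> q - r \<in> filt d n \<Longrightarrow> p - r \<in> filt d n"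
  using filt_closed(1)[of "p - q" d n "q - r"] by simp

lemma filt_diff_iff: "p - q \<in> filt d n \<Longrightarrow> p \<in> filt d n \<longleftrightarrow> q \<in> filt d n"
  using filt_closed(1)[of "p - q" d n q] filt_closed(2)[of p d n "p - q"] by auto

section \<open>Commuting letters modulo shorter words\<close>

lemma rel_ideal_context:
  "r \<in> rel_ideal d \<Longrightarrow> fa_mult (fa_mult (fa_word u) r) (fa_word v) \<in> rel_ideal d"
  by (intro rel_ideal.lmult rel_ideal.rmult fa_word_FA)

lemma swap_HE:
  "fa_word (u @ [Gh, Ge] @ v) - fa_word (u @ [Ge, Gh] @ v) + fa_word (u @ Ge # v) \<in> rel_ideal d"
proof -
  let ?r = "fa_sub (fa_sub (fa_mult gH gE) (fa_mult gE gH)) (fa_scale (-1) gE)"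
  have "?r \<in> rel_ideal d" by (rule rel_ideal.rel) (simp add: relations_def)
  from rel_ideal_context[OF this, of u v] show ?thesis
    by (simp add: fa_sub_eq_minus fa_gen_eq_word fa_mult_word fa_mult_diff_left fa_mult_diff_right
        fa_mult_add_left fa_mult_add_right
        del: minus_apply plus_fun_apply)
qed

lemma swap_EF:
  "fa_word (u @ [Ge, Gf] @ v) - fa_word (u @ [Gf, Ge] @ v)
     - (fa_scale (of_nat d) (fa_word (u @ v)) - fa_scale 2 (fa_word (u @ Gh # v))) \<in> rel_ideal d"
proof -
  let ?r = "fa_sub (fa_sub (fa_mult gE gF) (fa_mult gF gE))
             (fa_sub (fa_scale (of_nat d) fa_one) (fa_scale 2 gH))"
  have "?r \<in> rel_ideal d" by (rule rel_ideal.rel) (simp add: relations_def)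
  from rel_ideal_context[OF this, of u v] show ?thesis
    by (simp add: fa_sub_eq_minus fa_gen_eq_word fa_one_eq_word fa_mult_word fa_mult_diff_left fa_mult_diff_right
        fa_mult_scale_left fa_mult_scale_right del: minus_apply plus_fun_apply)
qed

lemma swap_HF:
  "fa_word (u @ [Gh, Gf] @ v) - fa_word (u @ [Gf, Gh] @ v) - fa_word (u @ Gf # v) \<in> rel_ideal d"
proof -
  let ?r = "fa_sub (fa_sub (fa_mult gH gF) (fa_mult gF gH)) gF"
  have "?r \<in> rel_ideal d" by (rule rel_ideal.rel) (simp add: relations_def)
  from rel_ideal_context[OF this, of u v] show ?thesis
    by (simp add: fa_sub_eq_minus fa_gen_eq_word fa_mult_word fa_mult_diff_left fa_mult_diff_right
        del: minus_apply plus_fun_apply)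
qed

text \<open>This and the next two brackets have the common shape [x, y] = kappa z modulo shorter
  words, as required by \<open>filt_move_block\<close>; hence the explicit factor 1.\<close>

lemma bracket_EH:
  "fa_word (u @ [Ge, Gh] @ v) - fa_word (u @ [Gh, Ge] @ v) - fa_scale 1 (fa_word (u @ Ge # v))
     \<in> filt d (length u + length v)"
  using filt_closed(4)[OF rel_ideal_filt[OF swap_HE]] by (simp add: algebra_simps del: minus_apply plus_fun_apply)

lemma bracket_FH:
  "fa_word (u @ [Gf, Gh] @ v) - fa_word (u @ [Gh, Gf] @ v) - fa_scale (- 1) (fa_word (u @ Gf # v))
     \<in> filt d (length u + length v)"
  using filt_closed(4)[OF rel_ideal_filt[OF swap_HF]] by (simp add: algebra_simps del: minus_apply plus_fun_apply)

text \<open>The constant d in the relation yields a word without the two letters, which the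
  filtration absorbs; only 2 H remains.\<close>

lemma bracket_FE:
  "fa_word (u @ [Gf, Ge] @ v) - fa_word (u @ [Ge, Gf] @ v) - fa_scale 2 (fa_word (u @ Gh # v))
     \<in> filt d (length u + length v)"
proof -
  have "fa_scale (of_nat d) (fa_word (u @ v)) \<in> filt d (length u + length v)"
    by (intro filt_closed filt_word) simp
  from filt_closed(2)[OF filt_closed(4)[OF rel_ideal_filt[OF swap_EF[of u v d]]] this] show ?thesis
    by (simp add: algebra_simps del: minus_apply plus_fun_apply)
qed

text \<open>Every bracket of two letters is a combination of a letter and a constant, so a swap
  costs only words at least one letter shorter.\<close>

lemma filt_swap:
  "fa_word (u @ [x, y] @ v) - fa_word (u @ [y, x] @ v) \<in> filt d (Suc (length u + length v))"
proof -
  have *: "fa_word (u @ [x, y] @ v) - fa_word (u @ [y, x] @ v) \<in> filt d (Suc (length u + length v))"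
    if "fa_word (u @ [x, y] @ v) - fa_word (u @ [y, x] @ v) - fa_scale c (fa_word (u @ z # v))
      \<in> filt d (length u + length v)" for x y z c
  proof -
    have "fa_scale c (fa_word (u @ z # v)) \<in> filt d (Suc (length u + length v))"
      by (intro filt_closed filt_word) simp
    moreover have "fa_word (u @ [x, y] @ v) - fa_word (u @ [y, x] @ v) - fa_scale c (fa_word (u @ z # v))
      \<in> filt d (Suc (length u + length v))"
      using that filt_mono[of "length u + length v" "Suc (length u + length v)"] by auto
    ultimately show ?thesis using filt_diff_iff by blast
  qed
  note EH = *[OF bracket_EH] and FH = *[OF bracket_FH] and FE = *[OF bracket_FE]
  show ?thesis
    by (cases x; cases y) (use EH FH FE filt_diff_sym filt_closed(5) in auto)
qed

lemma filt_move:
  assumes "length u + length s + length v \<le> n"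
  shows "fa_word (u @ x # s @ v) - fa_word (u @ s @ x # v) \<in> filt d n"
  using assms
proof (induction s arbitrary: u)
  case Nil
  then show ?case by (simp add: filt_closed del: minus_apply zero_fun_apply)
next
  case (Cons y s)
  have "fa_word (u @ [x, y] @ s @ v) - fa_word (u @ [y, x] @ s @ v) \<in> filt d n"
    using filt_swap[of u x y "s @ v" d] filt_mono[of "Suc (length u + length (s @ v))" n d] Cons.prems
    by auto
  moreover have "fa_word ((u @ [y]) @ x # s @ v) - fa_word ((u @ [y]) @ s @ x # v) \<in> filt d n"
    using Cons.prems by (intro Cons.IH) simp
  ultimately show ?case
    using filt_diff_trans[of "fa_word (u @ x # y # s @ v)" "fa_word (u @ y # x # s @ v)"]
    by (simp del: minus_apply)
qed

section \<open>Sorting words\<close>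

lemma count_list_replicate: "count_list (replicate n x) y = (if x = y then n else 0)"
  by (induction n) auto

lemma count_list_gen_sum: "count_list w Gf + count_list w Gh + count_list w Ge = length w"
proof (induction w)
  case (Cons y w)
  then show ?case by (cases y) auto
qed simp

definition pbw :: "nat \<Rightarrow> nat \<Rightarrow> nat \<Rightarrow> gen list" where
  "pbw a b c = replicate a Gf @ replicate b Gh @ replicate c Ge"

lemma length_pbw [simp]: "length (pbw a b c) = a + b + c"
  by (simp add: pbw_def)

text \<open>Modulo shorter words only the letter counts matter. After the tail is sorted, the first
  letter moves to its block: e past f and H, H past f, while f is already in place. The prefix u
  makes the induction hypothesis applicable after each letter.\<close>

lemma filt_normal_form:
  assumes "length u + length w \<le> Suc n"
  shows "fa_word (u @ w) - fa_word (u @ pbw (count_list w Gf) (count_list w Gh) (count_list w Ge))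
    \<in> filt d n"
  using assms
proof (induction w arbitrary: u)
  case Nil
  then show ?case by (simp add: pbw_def filt_closed del: minus_apply zero_fun_apply)
next
  case (Cons x w)
  let ?a = "count_list w Gf" and ?b = "count_list w Gh" and ?c = "count_list w Ge"
  note len = count_list_gen_sum[of w]
  have "fa_word ((u @ [x]) @ w) - fa_word ((u @ [x]) @ pbw ?a ?b ?c) \<in> filt d n"
    using Cons.prems by (intro Cons.IH) simp
  moreover have "fa_word (u @ x # pbw ?a ?b ?c) -
      fa_word (u @ pbw (count_list (x # w) Gf) (count_list (x # w) Gh) (count_list (x # w) Ge)) \<in> filt d n"
  proof (cases x)
    case Ge
    have "fa_word (u @ Ge # (replicate ?a Gf @ replicate ?b Gh) @ replicate ?c Ge) -
        fa_word (u @ (replicate ?a Gf @ replicate ?b Gh) @ Ge # replicate ?c Ge) \<in> filt d n"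
      using Cons.prems len by (intro filt_move) simp
    then show ?thesis by (simp add: Ge pbw_def del: minus_apply)
  next
    case Gf
    then show ?thesis by (simp add: pbw_def filt_closed del: minus_apply zero_fun_apply)
  next
    case Gh
    have "fa_word (u @ Gh # replicate ?a Gf @ (replicate ?b Gh @ replicate ?c Ge)) -
        fa_word (u @ replicate ?a Gf @ Gh # (replicate ?b Gh @ replicate ?c Ge)) \<in> filt d n"
      using Cons.prems len by (intro filt_move) simp
    then show ?thesis by (simp add: Gh pbw_def del: minus_apply)
  qed
  ultimately show ?case
    using filt_diff_trans[of "fa_word (u @ x # w)" "fa_word (u @ x # pbw ?a ?b ?c)"]
    by (simp del: minus_apply)
qed

text \<open>Keeps the first-order error of a move: each of the m swaps contributes kappa z at some
  place in the block. These words have at most n + 1 letters, so modulo \<open>filt d n\<close>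
  every z may be moved to the front.\<close>

lemma filt_move_block:
  assumes bracket: "\<And>u v. fa_word (u @ [x, y] @ v) - fa_word (u @ [y, x] @ v) -
      fa_scale \<kappa> (fa_word (u @ z # v)) \<in> filt d (length u + length v)"
    and "length u + m + length v \<le> Suc n"
  shows "fa_word (u @ x # replicate m y @ v) - fa_word (u @ replicate m y @ x # v) -
    fa_scale (of_nat m * \<kappa>) (fa_word (u @ z # replicate (m - 1) y @ v)) \<in> filt d n"
  using assms(2)
proof (induction m arbitrary: u)
  case 0
  then show ?case by (simp add: filt_closed del: minus_apply zero_fun_apply)
next
  case (Suc m)
  let ?B = "fa_word (u @ y # x # replicate m y @ v)"
  let ?C = "fa_word (u @ z # replicate m y @ v)"
  let ?D = "fa_word (u @ y # z # replicate (m - 1) y @ v)"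
  have 1: "fa_word (u @ x # replicate (Suc m) y @ v) - ?B - fa_scale \<kappa> ?C \<in> filt d n"
    using bracket[of u "replicate m y @ v"] filt_mono[of "length u + length (replicate m y @ v)" n d] Suc.prems
    by auto
  have 2: "?B - fa_word (u @ replicate (Suc m) y @ x # v) - fa_scale (of_nat m * \<kappa>) ?D \<in> filt d n"
    using Suc.IH[of "u @ [y]"] Suc.prems by (simp del: minus_apply)
  \<comment> \<open>The induction hypothesis leaves z behind the first y; exchanging the two stays
    within \<open>filt d n\<close>. For m = 0 the truncated exponent in \<open>?D\<close> is
    harmless because the coefficient is zero.\<close>
  have "fa_scale (of_nat m * \<kappa>) (?D - ?C) \<in> filt d n"
  proof (cases m)
    case 0
    then show ?thesis by (simp add: filt_closed del: minus_apply zero_fun_apply)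
  next
    case (Suc k)
    have "fa_word (u @ y # [z] @ replicate k y @ v) - fa_word (u @ [z] @ y # replicate k y @ v) \<in> filt d n"
      using Suc.prems Suc by (intro filt_move) simp
    then show ?thesis using Suc by (intro filt_closed(3)) simp
  qed
  from filt_closed(1)[OF filt_closed(1)[OF 1 2] this] show ?case
    by (simp add: algebra_simps fa.scale_left_distrib fa.scale_right_diff_distrib
        del: minus_apply plus_fun_apply)
qed

section \<open>Brackets and products with a generator\<close>

lemma filt_commutator_word:
  "length w \<le> n \<Longrightarrow> fa_word (x # w) - fa_word (w @ [x]) \<in> filt d n"
  using filt_move[of "[]" w "[]" n x d] by simp

text \<open>For a word, the bracket gains one letter and loses one by commutation; the ideal is
  two-sided. Thus from one monomial of degree d + 1 lying in \<open>filt d d\<close>, further ones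
  can be obtained by bracketing.\<close>

lemma filt_commutator:
  assumes "p \<in> filt d n"
  shows "fa_mult (fa_word [x]) p - fa_mult p (fa_word [x]) \<in> filt d n"
  using assms unfolding filt_def
proof (induction p rule: fa.span_induct_alt)
  case base
  then show ?case by (simp add: fa_mult_0_left fa_mult_0_right fa.span_zero del: zero_fun_apply)
next
  case (step c p q)
  have "fa_mult (fa_word [x]) p - fa_mult p (fa_word [x]) \<in> filt d n"
    using step(1)
  proof
    assume "p \<in> fa_word ` {w. length w \<le> n}"
    then show ?thesis using filt_commutator_word by (auto simp: fa_mult_word simp del: minus_apply)
  next
    assume "p \<in> rel_ideal d"
    then show ?thesis
      by (intro filt_closed rel_ideal_filt rel_ideal.lmult rel_ideal.rmult fa_word_FA)
  qed
  from filt_closed(1)[OF filt_closed(3)[OF this, of c] step(2)[folded filt_def]]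
  show ?case
    by (simp add: fa_mult_add_left fa_mult_add_right fa_mult_scale_left fa_mult_scale_right
        fa.scale_right_diff_distrib algebra_simps filt_def del: minus_apply plus_fun_apply)
qed

lemma filt_mult_right:
  assumes "p \<in> filt d n"
  shows "fa_mult p (fa_word [x]) \<in> filt d (Suc n)"
  using assms unfolding filt_def
proof (induction p rule: fa.span_induct_alt)
  case base
  then show ?case by (simp add: fa_mult_0_left fa.span_zero del: zero_fun_apply)
next
  case (step c p q)
  have "fa_mult p (fa_word [x]) \<in> filt d (Suc n)"
    using step(1) filt_word
    by (auto simp: fa_mult_word intro: rel_ideal_filt rel_ideal.rmult fa_word_FA)
  with step(2) show ?case
    by (simp add: fa_mult_add_left fa_mult_scale_left filt_def fa.span_add fa.span_scale del: plus_fun_apply)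
qed

section \<open>Monomials of degree d + 1\<close>

lemma hprod_filt: "hprod k - fa_word (replicate (Suc k) Gh) \<in> filt d k"
proof (induction k)
  case 0
  then show ?case by (simp add: fa_gen_eq_word filt_closed del: minus_apply zero_fun_apply)
next
  case (Suc k)
  let ?w = "fa_word (replicate (Suc k) Gh)"
  have "hprod k \<in> filt d (Suc k)"
    using Suc filt_mono[of k "Suc k" d] filt_word[of "replicate (Suc k) Gh" "Suc k" d]
    by (subst filt_diff_iff[of _ ?w]) (auto simp del: minus_apply)
  \<comment> \<open>This element equals \<open>hprod (Suc k)\<close> minus the next power of
    H.\<close>
  then have "fa_mult (hprod k - ?w) (fa_word [Gh]) - fa_scale (of_nat (Suc k)) (hprod k) \<in> filt d (Suc k)"
    by (rule filt_closed(2)[OF filt_mult_right[OF Suc] filt_closed(3)])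
  moreover have one: "fa_mult p (fa_word []) = p" for p
    by (auto simp: fa_mult_def fa_word_def fun_eq_iff if_distrib[of "(*) _"] cong: if_cong)
  ultimately show ?case
    by (simp add: fa_sub_eq_minus fa_mult_diff_right fa_mult_diff_left fa_mult_scale_right
        fa_gen_eq_word fa_one_eq_word fa_mult_word replicate_append_same algebra_simps
        del: minus_apply plus_fun_apply of_nat_Suc)
qed

text \<open>The last relation enters the spanning argument here: it expresses H^(d+1) by lower
  powers of H.\<close>

lemma filt_top_H: "fa_word (replicate (Suc d) Gh) \<in> filt d d"
proof -
  have "hprod d \<in> filt d d"
    by (intro rel_ideal_filt rel_ideal.rel) (simp add: relations_def)
  then show ?thesis using filt_diff_iff[OF hprod_filt[of d d]] by simp
qed

text \<open>Bracketing H^(m+1) e^c with e gives (m+1) H^m e^(c+1) modulo shorter words, and m + 1 is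
  invertible in the rationals.\<close>

lemma filt_top_step_E:
  assumes "Suc m + c = Suc d" "fa_word (pbw 0 (Suc m) c) \<in> filt d d"
  shows "fa_word (pbw 0 m (Suc c)) \<in> filt d d"
proof -
  let ?w = "fa_word (Ge # replicate m Gh @ replicate c Ge)"
  have "fa_word (Ge # pbw 0 (Suc m) c) - fa_word (replicate (Suc m) Gh @ replicate (Suc c) Ge)
      - fa_scale (of_nat (Suc m)) ?w \<in> filt d d"
    using filt_move_block[OF bracket_EH, of "[]" "Suc m" "replicate c Ge" d] assms(1)
    by (simp add: pbw_def del: minus_apply of_nat_Suc)
  moreover have "fa_word (Ge # pbw 0 (Suc m) c) - fa_word (replicate (Suc m) Gh @ replicate (Suc c) Ge)
      \<in> filt d d"
    using filt_commutator[OF assms(2), of Ge]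
    by (simp add: fa_mult_word pbw_def replicate_append_same del: minus_apply)
  ultimately have "fa_scale (of_nat (Suc m)) ?w \<in> filt d d"
    using filt_diff_iff by blast
  from filt_closed(3)[OF this, of "inverse (of_nat (Suc m))"] have "?w \<in> filt d d"
    by (simp del: of_nat_Suc)
  \<comment> \<open>The block lemma leaves the new e in front; sorting moves it to the other letters
    e.\<close>
  moreover have "?w - fa_word (pbw 0 m (Suc c)) \<in> filt d d"
    using filt_normal_form[of "[]" "Ge # replicate m Gh @ replicate c Ge" d d] assms(1)
    by (simp add: count_list_replicate del: minus_apply)
  ultimately show ?thesis using filt_diff_iff by blast
qed

text \<open>In the bracket of f with f^a H^(m+1) e^c, passing the H block gives -(m+1) f^(a+1) H^m
  e^c and passing the e block gives 2c f^a H^(m+2) e^(c-1). The last hypothesis disposes of the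
  second term.\<close>

lemma filt_top_step_F:
  assumes "a + Suc m + c = Suc d" "fa_word (pbw a (Suc m) c) \<in> filt d d"
    and c: "c = 0 \<or> fa_word (pbw a (Suc (Suc m)) (c - 1)) \<in> filt d d"
  shows "fa_word (pbw (Suc a) m c) \<in> filt d d"
proof -
  let ?u = "replicate a Gf" and ?h = "replicate (Suc m) Gh" and ?e = "replicate c Ge"
  let ?A = "fa_word (?u @ Gf # ?h @ ?e)" and ?B = "fa_word (?u @ ?h @ Gf # ?e)"
    and ?C = "fa_word (?u @ ?h @ ?e @ [Gf])"
    and ?X = "fa_word (?u @ Gf # replicate m Gh @ ?e)"
    and ?Y = "fa_word ((?u @ ?h) @ Gh # replicate (c - 1) Ge)"
  have 1: "?A - ?B - fa_scale (of_nat (Suc m) * - 1) ?X \<in> filt d d"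
    using filt_move_block[OF bracket_FH, of ?u "Suc m" ?e d] assms(1)
    by (simp del: minus_apply of_nat_Suc replicate_Suc) 
  have 2: "?B - ?C - fa_scale (of_nat c * 2) ?Y \<in> filt d d"
    using filt_move_block[OF bracket_FE, of "?u @ ?h" c "[]" d] assms(1)
    by (simp del: minus_apply of_nat_Suc replicate_Suc)
  have 3: "?A - ?C \<in> filt d d"
    using filt_commutator[OF assms(2), of Gf]
    by (simp add: fa_mult_word pbw_def replicate_app_Cons_same del: minus_apply)
  \<comment> \<open>Sorting turns \<open>?Y\<close> into the monomial of the last hypothesis. For c
    = 0 the coefficient vanishes, whatever the truncated exponent in \<open>?Y\<close>.\<close>
  have 4: "fa_scale (of_nat c * 2) ?Y \<in> filt d d"
  proof (cases "c = 0")
    case True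
    then show ?thesis by (simp add: filt_closed del: minus_apply zero_fun_apply)
  next
    case False
    have "?Y - fa_word (pbw a (Suc (Suc m)) (c - 1)) \<in> filt d d"
      using filt_normal_form[of "[]" "(?u @ ?h) @ Gh # replicate (c - 1) Ge" d d] assms(1) False
      by (simp add: count_list_replicate del: minus_apply)
    then show ?thesis using c False filt_diff_iff filt_closed(3) by blast
  qed
  have "fa_scale (of_nat (Suc m)) ?X = (?A - ?B - fa_scale (of_nat (Suc m) * - 1) ?X)
      + (?B - ?C - fa_scale (of_nat c * 2) ?Y) + fa_scale (of_nat c * 2) ?Y - (?A - ?C)"
    by (simp add: algebra_simps fa.scale_minus_left del: minus_apply plus_fun_apply of_nat_Suc)
  also have "\<dots> \<in> filt d d" by (intro filt_closed(1,2) 1 2 3 4)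
  finally have "fa_scale (of_nat (Suc m)) ?X \<in> filt d d" .
  from filt_closed(3)[OF this, of "inverse (of_nat (Suc m))"] show ?thesis
    by (simp add: pbw_def replicate_app_Cons_same del: of_nat_Suc)
qed

text \<open>Starting from H^(d+1), the inner induction trades letters H for e, the outer one for f.
  Raising a uses the previous level for both c and c - 1, so the hypothesis must be general in m and
  c.\<close>

lemma filt_top_pbw: "a + m + c = Suc d \<Longrightarrow> fa_word (pbw a m c) \<in> filt d d"
proof (induction a arbitrary: m c)
  case 0
  then show ?case
  proof (induction c arbitrary: m)
    case 0
    then show ?case using filt_top_H[of d] by (simp add: pbw_def)
  next
    case (Suc c)
    then show ?case by (intro filt_top_step_E) simp_all
  qed
next
  case (Suc a)
  have "fa_word (pbw a (Suc m) c) \<in> filt d d" using Suc.prems by (intro Suc.IH) simp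
  moreover have "c = 0 \<or> fa_word (pbw a (Suc (Suc m)) (c - 1)) \<in> filt d d"
    using Suc.prems Suc.IH[of "Suc (Suc m)" "c - 1"] by (cases c) simp_all
  ultimately show ?case using Suc.prems by (intro filt_top_step_F) simp_all
qed

section \<open>Reduction of arbitrary polynomials to monomials\<close>

lemma word_in_filt: "fa_word w \<in> filt d d"
proof (induction w rule: rev_induct)
  case Nil
  then show ?case by (simp add: filt_word)
next
  case (snoc x w)
  have top: "fa_word u \<in> filt d d" if "length u \<le> Suc d" for u
  proof (cases "length u = Suc d")
    case True
    have "fa_word u - fa_word (pbw (count_list u Gf) (count_list u Gh) (count_list u Ge)) \<in> filt d d"
      using filt_normal_form[of "[]" u d d] True by (simp del: minus_apply)
    moreover have "fa_word (pbw (count_list u Gf) (count_list u Gh) (count_list u Ge)) \<in> filt d d"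
      using True by (intro filt_top_pbw) (simp add: count_list_gen_sum)
    ultimately show ?thesis using filt_diff_iff by blast
  next
    case False
    with that show ?thesis by (intro filt_word) simp
  qed
  \<comment> \<open>The filtration stops growing at d, so a word can be extended by one letter at a
    time without leaving \<open>filt d d\<close>.\<close>
  have "filt d (Suc d) \<subseteq> filt d d"
    unfolding filt_def[of d "Suc d"]
    by (intro fa.span_minimal filt_subspace) (auto intro: top rel_ideal_filt)
  moreover have "fa_mult (fa_word w) (fa_word [x]) \<in> filt d (Suc d)"
    by (rule filt_mult_right) (rule snoc)
  ultimately show ?case by (auto simp: fa_mult_word)
qed

text \<open>Induction on the length: a word is its sorted form, which is one of the monomials, plus
  an element of the previous filtration step.\<close>

lemma filt_in_monom_span:
  "n \<le> d \<Longrightarrow> filt d n \<subseteq> fa.span (Defs.monom ` monom_idx d \<union> rel_ideal d)"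
proof (induction n)
  case 0
  have "fa_word [] = Defs.monom (0, 0, 0)" by (simp add: monom_eq_word)
  moreover have "(0, 0, 0) \<in> monom_idx d" by (simp add: monom_idx_def)
  ultimately show ?case unfolding filt_def by (intro fa.span_mono) auto
next
  case (Suc n)
  let ?L = "fa.span (Defs.monom ` monom_idx d \<union> rel_ideal d)"
  have "fa_word w \<in> ?L" if "length w \<le> Suc n" for w
  proof -
    let ?a = "count_list w Gf" and ?b = "count_list w Gh" and ?c = "count_list w Ge"
    have "fa_word w - fa_word (pbw ?a ?b ?c) \<in> filt d n"
      using filt_normal_form[of "[]" w n d] that by simp
    then have "fa_word w - fa_word (pbw ?a ?b ?c) \<in> ?L"
      using Suc by auto
    moreover have "fa_word (pbw ?a ?b ?c) \<in> ?L"
    proof (rule fa.span_base, rule UnI1, rule image_eqI)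
      show "fa_word (pbw ?a ?b ?c) = Defs.monom (?a, ?b, ?c)"
        by (simp add: monom_eq_word pbw_def)
      show "(?a, ?b, ?c) \<in> monom_idx d"
        using that Suc.prems by (simp add: monom_idx_def count_list_gen_sum)
    qed
    ultimately show ?thesis using fa.span_add by fastforce
  qed
  then show ?case unfolding filt_def
    by (intro fa.span_minimal) (auto intro: fa.span_base)
qed

lemma monom_spanning:
  assumes "p \<in> FA"
  obtains k where "p - lin_comb d k \<in> rel_ideal d"
proof -
  \<comment> \<open>Polynomials congruent to a combination of monomials form a subspace, which turns
    membership in the span into a single coefficient function.\<close>
  let ?S = "{p. \<exists>k. p - lin_comb d k \<in> rel_ideal d}"
  note ideal = rel_ideal_subspace[of d]
  have "fa.subspace ?S"
  proof (rule fa.subspaceI)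
    have "0 - lin_comb d (\<lambda>_. 0) = 0" by (simp add: lin_comb_def fun_eq_iff)
    then show "0 \<in> ?S"
      by (intro CollectI exI[of _ "\<lambda>_. 0"]) (simp only: fa.subspace_0[OF ideal])
    show "p + q \<in> ?S" if pq: "p \<in> ?S" "q \<in> ?S" for p q
    proof -
      from pq obtain k l where kl: "p - lin_comb d k \<in> rel_ideal d" "q - lin_comb d l \<in> rel_ideal d" by auto
      have "lin_comb d (\<lambda>m. k m + l m) = lin_comb d k + lin_comb d l"
        by (simp add: lin_comb_def fun_eq_iff distrib_right sum.distrib)
      then have "p + q - lin_comb d (\<lambda>m. k m + l m) = (p - lin_comb d k) + (q - lin_comb d l)"
        by simp
      then show ?thesis
        by (intro CollectI exI[of _ "\<lambda>m. k m + l m"]) (simp only: fa.subspace_add[OF ideal kl])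
    qed
    show "fa_scale c p \<in> ?S" if "p \<in> ?S" for c p
    proof -
      from that obtain k where k: "p - lin_comb d k \<in> rel_ideal d" by auto
      have "lin_comb d (\<lambda>m. c * k m) = fa_scale c (lin_comb d k)"
        by (simp add: lin_comb_def fa_scale_def fun_eq_iff sum_distrib_left mult.assoc)
      then have "fa_scale c p - lin_comb d (\<lambda>m. c * k m) = fa_scale c (p - lin_comb d k)"
        by (simp add: fa.scale_right_diff_distrib)
      then show ?thesis
        by (intro CollectI exI[of _ "\<lambda>m. c * k m"]) (simp only: fa.subspace_scale[OF ideal k])
    qed
  qed
  moreover have "Defs.monom ` monom_idx d \<union> rel_ideal d \<subseteq> ?S"
  proof
    fix p assume "p \<in> Defs.monom ` monom_idx d \<union> rel_ideal d"
    then show "p \<in> ?S"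
    proof
      assume "p \<in> Defs.monom ` monom_idx d"
      then obtain m where m: "p = Defs.monom m" "m \<in> monom_idx d" by auto
      have "lin_comb d (\<lambda>n. if n = m then 1 else 0) = p"
        using m finite_monom_idx by (simp add: lin_comb_def fun_eq_iff if_distrib[of "\<lambda>x. x * _"] cong: if_cong)
      then have "p - lin_comb d (\<lambda>n. if n = m then 1 else 0) = 0" by simp
      then show ?thesis
        by (intro CollectI exI[of _ "\<lambda>n. if n = m then 1 else 0"])
          (simp only: fa.subspace_0[OF ideal])
    next
      assume p: "p \<in> rel_ideal d"
      have "p - lin_comb d (\<lambda>_. 0) = p" by (simp add: lin_comb_def fun_eq_iff)
      then show ?thesis
        by (intro CollectI exI[of _ "\<lambda>_. 0"]) (simp only: p)
    qed
  qed
  ultimately have "fa.span (Defs.monom ` monom_idx d \<union> rel_ideal d) \<subseteq> ?S"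
    by (rule fa.span_minimal[rotated])
  moreover have "FA \<subseteq> filt d d"
    unfolding FA_eq_span by (intro fa.span_minimal filt_subspace) (auto intro: word_in_filt)
  ultimately have "p \<in> ?S" using assms filt_in_monom_span[of d d] by blast
  then show thesis using that by blast
qed

section \<open>Kernel, image and basis of the presented algebra\<close>

theorem theorem2p3:
  fixes d :: nat
  shows "(\<exists>\<phi>. alg_hom d \<phi> \<and> \<phi> ` FA = schur d \<and>
              {p \<in> FA. \<phi> p = (\<lambda>v w. 0)} = rel_ideal d)
       \<and> (\<forall>k. lin_comb d k \<in> rel_ideal d \<longrightarrow> (\<forall>m\<in>monom_idx d. k m = 0))
       \<and> (\<forall>p\<in>FA. \<exists>k. fa_sub p (lin_comb d k) \<in> rel_ideal d)"
proof (intro conjI)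
  have zero: "(\<lambda>v w. 0) = (0 :: endo)" by (simp add: fun_eq_iff)
  have "{p \<in> FA. rep d p = 0} = rel_ideal d"
  proof
    show "rel_ideal d \<subseteq> {p \<in> FA. rep d p = 0}" using rel_ideal_kernel by blast
    show "{p \<in> FA. rep d p = 0} \<subseteq> rel_ideal d"
    proof clarify
      fix p assume p: "p \<in> FA" "rep d p = 0"
      \<comment> \<open>Modulo the ideal p is a combination of monomials, which is again killed by
        \<open>rep d\<close>. Independence of the monomials in the image forces all its coefficients
        to vanish, so p itself lies in the ideal.\<close>
      obtain k where k: "p - lin_comb d k \<in> rel_ideal d" using monom_spanning[OF p(1)] .
      have "lin_comb d k \<in> FA"
        by (simp add: lin_comb_eq_sum FA_sum FA_scale monom_FA)
      then have "rep d (lin_comb d k) = 0"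
        using rel_ideal_kernel[OF k] rep_diff[OF p(1)] p(2) by simp
      then have "k m = 0" if "m \<in> monom_idx d" for m
        using that by (cases m) (auto intro: monom_independent)
      then have "lin_comb d k = 0" by (simp add: lin_comb_def fun_eq_iff)
      with k show "p \<in> rel_ideal d" by simp
    qed
  qed
  then show "\<exists>\<phi>. alg_hom d \<phi> \<and> \<phi> ` FA = schur d \<and> {p \<in> FA. \<phi> p = (\<lambda>v w. 0)} = rel_ideal d"
    using alg_hom_rep rep_range unfolding zero by blast
  show "\<forall>k. lin_comb d k \<in> rel_ideal d \<longrightarrow> (\<forall>m\<in>monom_idx d. k m = 0)"
    using rel_ideal_kernel monom_independent by fast
  show "\<forall>p\<in>FA. \<exists>k. fa_sub p (lin_comb d k) \<in> rel_ideal d"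
    unfolding fa_sub_eq_minus by (blast elim: monom_spanning)
qed

end
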